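(* Consider the integrated satellite-terrestrial uplink system described in the context, in which the satellite gateway and the APs use maximum-ratio combining (MRC), i.e. $\mathbf{u}_k=\hat{\mathbf{g}}_k$ and $u_{mk}=\hat g_{mk}$ for all $m,k$. For each active user $k\in\mathcal{Q}$ define $z_{kk'}=\mathbf{u}_k^H\mathbf{g}_{k'}+\sum_{m=1}^M u_{mk}^\ast g_{mk'}$ and the effective SINR $$\mathrm{SINR}_k=\frac{\rho_k|\mathbb{E}\{z_{kk}\}|^2}{\sum_{k'\in\mathcal{Q}}\rho_{k'}\mathbb{E}\{|z_{kk'}|^2\}-\rho_k|\mathbb{E}\{z_{kk}\}|^2+\mathbb{E}\{|\mathbf{u}_k^H\mathbf{w}|^2\}+\sum_{m=1}^M\mathbb{E}\{|u_{mk}^\ast w_m|^2\}},$$ with uplink ergodic throughput $R_k=B(1-\tau_p/\tau_c)\log_2(1+\mathrm{SINR}_k)$. Then $R_k=B(1-\tau_p/\tau_c)\log_2(1+\mathrm{SINR}_k)$ with $\mathrm{SINR}_k$ given in closed form by $$\mathrm{SINR}_k=\frac{\rho_k\left(\|\bar{\mathbf{g}}_k\|^2+p\tau_p\,\mathrm{tr}(\mathbf{R}_k\boldsymbol{\Phi}_k\mathbf{R}_k)+\sum_{m=1}^M\gamma_{mk}\right)^2}{\mathsf{MI}_k+\mathsf{NO}_k},$$ where $$\mathsf{MI}_k=\sum_{k'\in\mathcal{P}_k\setminus\{k\}}\rho_{k'}\Big|\bar{\mathbf{g}}_k^H\bar{\mathbf{g}}_{k'}+p\tau_p\,\mathrm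{tr}(\mathbf{R}_{k'}\boldsymbol{\Phi}_k\mathbf{R}_k)+\sum_{m=1}^M\frac{c_{mk'}}{c_{mk}}\gamma_{mk}\Big|^2+\sum_{k'\in\mathcal{K}\setminus\mathcal{P}_k}\rho_{k'}|\bar{\mathbf{g}}_k^H\bar{\mathbf{g}}_{k'}|^2+p\tau_p\sum_{k'\in\mathcal{Q}}\rho_{k'}\bar{\mathbf{g}}_{k'}^H\mathbf{R}_k\boldsymbol{\Phi}_k\mathbf{R}_k\bar{\mathbf{g}}_{k'}+\sum_{k'\in\mathcal{Q}}\rho_{k'}\bar{\mathbf{g}}_k^H\mathbf{R}_{k'}\bar{\mathbf{g}}_k+p\tau_p\sum_{k'\in\mathcal{Q}}\rho_{k'}\mathrm{tr}(\mathbf{R}_{k'}\mathbf{R}_k\boldsymbol{\Phi}_k\mathbf{R}_k)+\sum_{k'\in\mathcal{Q}}\sum_{m=1}^M\rho_{k'}\gamma_{mk}\beta_{mk'},$$ $$\mathsf{NO}_k=\sigma_s^2\|\bar{\mathbf{g}}_k\|^2+p\tau_p\sigma_s^2\,\mathrm{tr}(\mathbf{R}_k\boldsymbol{\Phi}_k\mathbf{R}_k)+\sigma_a^2\sum_{m=1}^M\gamma_{mk}.$$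
   Context: System: $M$ single-antenna access points (APs) indexed by $m\in\{1,\dots,M\}$, $K$ single-antenna users indexed by $k\in\mathcal{K}=\{1,\dots,K\}$, and one satellite with $N$ antennas. The AP–user channels $g_{mk}\sim\mathcal{CN}(0,\beta_{mk})$ ($\beta_{mk}>0$) and satellite–user channels $\mathbf{g}_k\sim\mathcal{CN}(\bar{\mathbf{g}}_k,\mathbf{R}_k)$ ($\bar{\mathbf{g}}_k\in\mathbb{C}^N$, $\mathbf{R}_k\in\mathbb{C}^{N\times N}$ Hermitian positive semidefinite) are all mutually independent. Each coherence interval has $\tau_c$ symbols, $\tau_p$ of which are used for pilots; $B$ is the bandwidth. Pilots: $\tau_p$ orthonormal pilot sequences are reused; $\mathcal{P}_k\subseteq\mathcal{K}$ denotes the set of users assigned the same pilot as user $k$ (so $k\in\mathcal{P}_k$, and $k'\in\mathcal{P}_k\iff\mathcal{P}_{k'}=\mathcal{P}_k$). With pilot power $p$, after projection onto user $k$'s pilot, AP $m$ observes $y_{pmk}=\sqrt{p\tau_p}\sum_{k'\in\mathcal{P}_k}g_{mk'}+n_{mk}$ with $n_{mk}\sim\mathcal{CN}(0,\sigma_a^2)$, and the satellite gateway observes $\mathbf{y}_{pk}=\sqrt{p\tau_p}\sum_{k'\in\mathcal{P}_k}\mathbf{g}_{k'}+\tilde{\mathbf{w}}_{pk}$ with $\tilde{\mathbf{w}}_{pk}\sim\mathcal{CN}(\mathbf{0},\sigma_s^2\mathbf{I}_N)$, noises independent of the channels (and of each other across distinct pilots). Channel estimates are MMSE: $\hat g_{mk}=\mathbb{E}\{g_{mk}|y_{pmk}\}=c_{mk}y_{pmk}$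 with $c_{mk}=\frac{\sqrt{p\tau_p}\beta_{mk}}{\sum_{k'\in\mathcal{P}_k}p\tau_p\beta_{mk'}+\sigma_a^2}$, so $\hat g_{mk}\sim\mathcal{CN}(0,\gamma_{mk})$ with $\gamma_{mk}=\frac{p\tau_p\beta_{mk}^2}{\sum_{k'\in\mathcal{P}_k}p\tau_p\beta_{mk'}+\sigma_a^2}$; and $\hat{\mathbf{g}}_k=\mathbb{E}\{\mathbf{g}_k|\mathbf{y}_{pk}\}=\bar{\mathbf{g}}_k+\sqrt{p\tau_p}\mathbf{R}_k\boldsymbol{\Phi}_k\big(\mathbf{y}_{pk}-\sqrt{p\tau_p}\sum_{k'\in\mathcal{P}_k}\bar{\mathbf{g}}_{k'}\big)$ with $\boldsymbol{\Phi}_k=\big(\sum_{k'\in\mathcal{P}_k}p\tau_p\mathbf{R}_{k'}+\sigma_s^2\mathbf{I}_N\big)^{-1}$, so $\hat{\mathbf{g}}_k\sim\mathcal{CN}(\bar{\mathbf{g}}_k,p\tau_p\mathbf{R}_k\boldsymbol{\Phi}_k\mathbf{R}_k)$. Data phase: a subset $\mathcal{Q}\subseteq\mathcal{K}$ of active users transmits independent zero-mean unit-variance symbols $s_k$ with powers $\rho_k\ge 0$ (inactive users $k\notin\mathcal{Q}$ transmit with zero power, $\rho_k=0$). The satellite receives $\mathbf{y}=\sum_{k\in\mathcal{Q}}\sqrt{\rho_k}\mathbf{g}_ks_k+\mathbf{w}$ and AP $m$ receives $y_m=\sum_{k\in\mathcal{Q}}\sqrt{\rho_k}g_{mk}s_k+w_m$,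 with $\mathbf{w}\sim\mathcal{CN}(\mathbf{0},\sigma_s^2\mathbf{I}_N)$, $w_m\sim\mathcal{CN}(0,\sigma_a^2)$ independent of everything else. The CPU forms $\hat s_k=\mathbf{u}_k^H\mathbf{y}+\sum_{m=1}^M u_{mk}^\ast y_m$. *)

theory Defs
  imports "HOL-Analysis.Analysis" "HOL-Probability.Probability"
begin

definition hip :: "complex^'n \<Rightarrow> complex^'n \<Rightarrow> complex" where
  "hip a b = (\<Sum>j\<in>UNIV. cnj (a $ j) * b $ j)"

definition hermitian_psd :: "complex^'n^'n \<Rightarrow> bool" where
  "hermitian_psd R \<longleftrightarrow> (\<forall>i j. R $ i $ j = cnj (R $ j $ i)) \<and>
                         (\<forall>x. 0 \<le> Re (hip x (R *v x)))"

definition cgauss :: "'a measure \<Rightarrow> ('a \<Rightarrow> complex) \<Rightarrow> real \<Rightarrow> bool" where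
  "cgauss M X v \<longleftrightarrow> X \<in> borel_measurable M \<and>
     (if v = 0 then (AE \<omega> in M. X \<omega> = 0)
      else 0 < v \<and>
        distributed M lborel (\<lambda>\<omega>. Re (X \<omega>)) (\<lambda>x. ennreal (normal_density 0 (sqrt (v / 2)) x)) \<and>
        distributed M lborel (\<lambda>\<omega>. Im (X \<omega>)) (\<lambda>x. ennreal (normal_density 0 (sqrt (v / 2)) x)) \<and>
        prob_space.indep_var M borel (\<lambda>\<omega>. Re (X \<omega>)) borel (\<lambda>\<omega>. Im (X \<omega>)))"

text \<open>Circularly-symmetric complex Gaussian random vector CN(mu,R): every linear functional
  a^H (X - mu) is scalar CN(0, a^H R a) (Cramer--Wold characterisation).\<close>
definition cgauss_vec :: "'a measure \<Rightarrow> ('a \<Rightarrow> complex^'n) \<Rightarrow> complex^'n \<Rightarrow> complex^'n^'n \<Rightarrow> bool" where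
  "cgauss_vec M X mu R \<longleftrightarrow> X \<in> borel_measurable M \<and>
     (\<forall>a. cgauss M (\<lambda>\<omega>. hip a (X \<omega> - mu)) (Re (hip a (R *v a))))"

definition gen_events :: "'a measure \<Rightarrow> ('a \<Rightarrow> 'b) \<Rightarrow> 'b measure \<Rightarrow> 'a set set" where
  "gen_events M X N = {X -` A \<inter> space M | A. A \<in> sets N}"

datatype rv_index =
    ApCh nat nat
  | SatCh nat        \<comment> \<open>satellite channel of user k\<close>
  | ApPil nat nat    \<comment> \<open>pilot noise at AP m for pilot t\<close>
  | SatPil nat       \<comment> \<open>pilot noise at satellite for pilot t\<close>
  | ApDat nat        \<comment> \<open>data noise w_m\<close>
  | SatDat           \<comment> \<open>data noise vector w\<close>

definition pset :: "nat \<Rightarrow> (nat \<Rightarrow> nat) \<Rightarrow> nat \<Rightarrow> nat set" where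
  "pset K pil k = {k' \<in> {1..K}. pil k' = pil k}"

text \<open>In the following, pt stands for the product p * tau_p, P for the pilot sets P_k.\<close>
definition cmmse :: "real \<Rightarrow> real \<Rightarrow> (nat \<Rightarrow> nat \<Rightarrow> real) \<Rightarrow> (nat \<Rightarrow> nat set) \<Rightarrow> nat \<Rightarrow> nat \<Rightarrow> real" where
  "cmmse pt sa2 beta P m k = sqrt pt * beta m k / ((\<Sum>k'\<in>P k. pt * beta m k') + sa2)"

definition gmmse :: "real \<Rightarrow> real \<Rightarrow> (nat \<Rightarrow> nat \<Rightarrow> real) \<Rightarrow> (nat \<Rightarrow> nat set) \<Rightarrow> nat \<Rightarrow> nat \<Rightarrow> real" where
  "gmmse pt sa2 beta P m k = pt * (beta m k)\<^sup>2 / ((\<Sum>k'\<in>P k. pt * beta m k') + sa2)"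

definition Phimat :: "real \<Rightarrow> real \<Rightarrow> (nat \<Rightarrow> complex^'n^'n) \<Rightarrow> (nat \<Rightarrow> nat set) \<Rightarrow> nat \<Rightarrow> complex^'n^'n" where
  "Phimat pt ss2 Rm P k = matrix_inv ((\<Sum>k'\<in>P k. pt *\<^sub>R Rm k') + ss2 *\<^sub>R mat 1)"

text \<open>MMSE estimate at AP m of g_{mk}: c_{mk} y_{pmk}, with y_{pmk} built from the
  channels g and the pilot noise na m t of pilot t = pil k.\<close>
definition ap_est :: "real \<Rightarrow> real \<Rightarrow> (nat \<Rightarrow> nat \<Rightarrow> real) \<Rightarrow> (nat \<Rightarrow> nat set) \<Rightarrow> (nat \<Rightarrow> nat)
    \<Rightarrow> (nat \<Rightarrow> nat \<Rightarrow> 'a \<Rightarrow> complex) \<Rightarrow> (nat \<Rightarrow> nat \<Rightarrow> 'a \<Rightarrow> complex) \<Rightarrow> nat \<Rightarrow> nat \<Rightarrow> 'a \<Rightarrow> complex" where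
  "ap_est pt sa2 beta P pil g na m k \<omega> =
     complex_of_real (cmmse pt sa2 beta P m k) *
       (complex_of_real (sqrt pt) * (\<Sum>k'\<in>P k. g m k' \<omega>) + na m (pil k) \<omega>)"

definition sat_est :: "real \<Rightarrow> real \<Rightarrow> (nat \<Rightarrow> complex^'n^'n) \<Rightarrow> (nat \<Rightarrow> complex^'n) \<Rightarrow> (nat \<Rightarrow> nat set)
    \<Rightarrow> (nat \<Rightarrow> nat) \<Rightarrow> (nat \<Rightarrow> 'a \<Rightarrow> complex^'n) \<Rightarrow> (nat \<Rightarrow> 'a \<Rightarrow> complex^'n) \<Rightarrow> nat \<Rightarrow> 'a \<Rightarrow> complex^'n" where
  "sat_est pt ss2 Rm gbar P pil gs nsat k \<omega> =
     gbar k + sqrt pt *\<^sub>R ((Rm k ** Phimat pt ss2 Rm P k) *v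
        ((sqrt pt *\<^sub>R (\<Sum>k'\<in>P k. gs k' \<omega>) + nsat (pil k) \<omega>) - sqrt pt *\<^sub>R (\<Sum>k'\<in>P k. gbar k')))"

definition zcomb :: "nat \<Rightarrow> (nat \<Rightarrow> nat \<Rightarrow> 'a \<Rightarrow> complex) \<Rightarrow> (nat \<Rightarrow> 'a \<Rightarrow> complex^'n)
    \<Rightarrow> (nat \<Rightarrow> nat \<Rightarrow> 'a \<Rightarrow> complex) \<Rightarrow> (nat \<Rightarrow> 'a \<Rightarrow> complex^'n) \<Rightarrow> nat \<Rightarrow> nat \<Rightarrow> 'a \<Rightarrow> complex" where
  "zcomb M uap usat g gs k k' \<omega> = hip (usat k \<omega>) (gs k' \<omega>) + (\<Sum>m\<in>{1..M}. cnj (uap m k \<omega>) * g m k' \<omega>)"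

definition sinr_eff :: "'a measure \<Rightarrow> nat \<Rightarrow> nat set \<Rightarrow> (nat \<Rightarrow> real) \<Rightarrow> (nat \<Rightarrow> nat \<Rightarrow> 'a \<Rightarrow> complex)
    \<Rightarrow> (nat \<Rightarrow> 'a \<Rightarrow> complex^'n) \<Rightarrow> (nat \<Rightarrow> nat \<Rightarrow> 'a \<Rightarrow> complex) \<Rightarrow> (nat \<Rightarrow> 'a \<Rightarrow> complex^'n)
    \<Rightarrow> (nat \<Rightarrow> 'a \<Rightarrow> complex) \<Rightarrow> ('a \<Rightarrow> complex^'n) \<Rightarrow> nat \<Rightarrow> real" where
  "sinr_eff PS M Q rho uap usat g gs wa ws k =
     (let z = zcomb M uap usat g gs;
          DS = rho k * (cmod (LINT \<omega>|PS. z k k \<omega>))\<^sup>2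
      in DS / ((\<Sum>k'\<in>Q. rho k' * (LINT \<omega>|PS. (cmod (z k k' \<omega>))\<^sup>2)) - DS
               + (LINT \<omega>|PS. (cmod (hip (usat k \<omega>) (ws \<omega>)))\<^sup>2)
               + (\<Sum>m\<in>{1..M}. LINT \<omega>|PS. (cmod (cnj (uap m k \<omega>) * wa m \<omega>))\<^sup>2)))"

definition rate :: "real \<Rightarrow> nat \<Rightarrow> nat \<Rightarrow> real \<Rightarrow> real" where
  "rate B tp tc s = B * (1 - real tp / real tc) * log 2 (1 + s)"

definition sinr_closed :: "nat \<Rightarrow> nat \<Rightarrow> nat set \<Rightarrow> (nat \<Rightarrow> real) \<Rightarrow> real \<Rightarrow> real \<Rightarrow> real
    \<Rightarrow> (nat \<Rightarrow> nat \<Rightarrow> real) \<Rightarrow> (nat \<Rightarrow> complex^'n) \<Rightarrow> (nat \<Rightarrow> complex^'n^'n) \<Rightarrow> (nat \<Rightarrow> nat set) \<Rightarrow> nat \<Rightarrow> complex" where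
  "sinr_closed K M Q rho pt sa2 ss2 beta gbar Rm P k =
     (let c = cmmse pt sa2 beta P;
          gam = gmmse pt sa2 beta P;
          Phi = Phimat pt ss2 Rm P;
          num = complex_of_real ((norm (gbar k))\<^sup>2) + complex_of_real pt * trace (Rm k ** Phi k ** Rm k)
                + complex_of_real (\<Sum>m\<in>{1..M}. gam m k);
          MI = (\<Sum>k'\<in>P k - {k}. complex_of_real (rho k' * (cmod (hip (gbar k) (gbar k')
                   + complex_of_real pt * trace (Rm k' ** Phi k ** Rm k)
                   + complex_of_real (\<Sum>m\<in>{1..M}. c m k' / c m k * gam m k)))\<^sup>2))
             + (\<Sum>k'\<in>{1..K} - P k. complex_of_real (rho k' * (cmod (hip (gbar k) (gbar k')))\<^sup>2))
             + complex_of_real pt * (\<Sum>k'\<in>Q. complex_of_real (rho k') * hip (gbar k') ((Rm k ** Phi k ** Rm k) *v gbar k'))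
             + (\<Sum>k'\<in>Q. complex_of_real (rho k') * hip (gbar k) (Rm k' *v gbar k))
             + complex_of_real pt * (\<Sum>k'\<in>Q. complex_of_real (rho k') * trace (Rm k' ** Rm k ** Phi k ** Rm k))
             + complex_of_real (\<Sum>k'\<in>Q. \<Sum>m\<in>{1..M}. rho k' * gam m k * beta m k');
          NO = complex_of_real (ss2 * (norm (gbar k))\<^sup>2)
             + complex_of_real (pt * ss2) * trace (Rm k ** Phi k ** Rm k)
             + complex_of_real (sa2 * (\<Sum>m\<in>{1..M}. gam m k))
      in complex_of_real (rho k) * num\<^sup>2 / (MI + NO))"


end

theory Submission
  imports Defs
begin

text \<open>The SINR only involves first and second moments of sums of \<open>cnj (a + e) * (b + h)\<close> with
  \<open>e\<close>, \<open>h\<close> jointly circularly symmetric Gaussian, hence only joint moments of order at most four.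
  Instead of showing that linear combinations of independent circular Gaussians are Gaussian, we only
  follow the moment identities \<open>E X = E X\<^sup>2 = E \<bar>X\<bar>\<^sup>2 X = 0\<close> and \<open>E \<bar>X\<bar>\<^sup>4 = 2 (E \<bar>X\<bar>\<^sup>2)\<^sup>2\<close>, which are
  stable under scaling and independent sums. On a complex linear space of such variables,
  polarisation turns them into Isserlis' formula
  \<open>E (X Y cnj U cnj W) = E (X cnj U) E (Y cnj W) + E (X cnj W) E (Y cnj U)\<close>, so everything reduces to
  the covariances of channels, MMSE estimates and noise.\<close>

section \<open>Moments of circularly symmetric Gaussian variables\<close>

text \<open>The obstacle is dependence: under MRC the combiner is random and, for users sharing the
  pilot of \<open>k\<close>, correlated with the channel that it multiplies, so the second moment of
  \<open>z\<close> does not factor. Isserlis' formula absorbs this correlation into the mean. For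
  means a, b and fluctuations e, h with covariances C (estimate) and R (channel), the second moment
  of the satellite part is |mean|^2 + a^H R a + b^H C b + tr (R C); the AP part has zero means and
  adds only to the mean and to the trace-like term. This is the shape of the closed form: |mean|^2
  yields the two sums of coherent interference, with the trace and the coefficient ratio present
  only under a shared pilot, and the other three terms yield the sums over \<open>Q\<close>. The
  noise terms are the same computation with b = 0 and h the receiver noise. The distributional
  hypotheses concern each source separately; joint moments become accessible because all linear
  functionals of the independent sources are collected in one complex linear space.\<close>

lemma power4_add_le:
  fixes x y :: real
  assumes "0 \<le> x" "0 \<le> y"
  shows "(x + y) ^ 4 \<le> 8 * (x ^ 4 + y ^ 4)"
proof -
  have "(x + y)\<^sup>2 \<le> 2 * (x\<^sup>2 + y\<^sup>2)"
    using sum_squares_bound[of x y] by (simp add: power2_sum algebra_simps)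
  then have "((x + y)\<^sup>2)\<^sup>2 \<le> (2 * (x\<^sup>2 + y\<^sup>2))\<^sup>2"
    by (intro power_mono) auto
  also have "\<dots> \<le> 4 * (2 * ((x\<^sup>2)\<^sup>2 + (y\<^sup>2)\<^sup>2))"
    using sum_squares_bound[of "x\<^sup>2" "y\<^sup>2"] by (simp add: power_mult_distrib power2_sum algebra_simps)
  finally show ?thesis
    by (simp flip: power_mult)
qed

text \<open>Every factor is at most the largest one. The bound serves as the integrable majorant of
  a product of four variables.\<close>

lemma prod4_le:
  fixes x y u w :: real
  assumes "0 \<le> x" "0 \<le> y" "0 \<le> u" "0 \<le> w"
  shows "x * y * u * w \<le> x ^ 4 + y ^ 4 + u ^ 4 + w ^ 4"
proof -
  define m where "m = max (max x y) (max u w)"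
  have "x * y * u * w \<le> m * m * m * m"
    unfolding m_def using assms by (intro mult_mono) auto
  also have "\<dots> = m ^ 4"
    by (simp add: power4_eq_xxxx)
  also have "\<dots> \<le> x ^ 4 + y ^ 4 + u ^ 4 + w ^ 4"
  proof -
    have "m = x \<or> m = y \<or> m = u \<or> m = w"
      unfolding m_def by (auto simp: max_def)
    moreover have "0 \<le> x ^ 4" "0 \<le> y ^ 4" "0 \<le> u ^ 4" "0 \<le> w ^ 4"
      using assms by auto
    ultimately show ?thesis
      by (elim disjE) simp_all
  qed
  finally show ?thesis .
qed

lemma borel_measurable_cnj [measurable]: "cnj \<in> borel_measurable borel"
  by (intro borel_measurable_continuous_onI continuous_intros)

section \<open>Fourth-order integrability and covariance\<close>

context prob_space
begin

text \<open>Order four is what |z|^2 requires when z is bilinear in the variables. The class is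
  closed under linear combinations, so integrability side conditions are discharged once and for
  all.\<close>

definition L4 :: "('a \<Rightarrow> complex) \<Rightarrow> bool" where
  "L4 X \<longleftrightarrow> X \<in> borel_measurable M \<and> integrable M (\<lambda>\<omega>. cmod (X \<omega>) ^ 4)"

lemma L4_const: "L4 (\<lambda>_. c)"
  by (simp add: L4_def)

lemma L4_cnj:
  assumes "L4 X"
  shows "L4 (\<lambda>\<omega>. cnj (X \<omega>))"
proof -
  have [measurable]: "X \<in> borel_measurable M"
    using assms by (simp add: L4_def)
  have "(\<lambda>\<omega>. cnj (X \<omega>)) \<in> borel_measurable M"
    by measurable
  with assms show ?thesis
    by (simp add: L4_def)
qed

lemma L4_cmult:
  assumes "L4 X"
  shows "L4 (\<lambda>\<omega>. c * X \<omega>)"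
proof -
  have [measurable]: "X \<in> borel_measurable M"
    using assms by (simp add: L4_def)
  have "(\<lambda>\<omega>. c * X \<omega>) \<in> borel_measurable M"
    by measurable
  with assms show ?thesis
    by (simp add: L4_def norm_mult power_mult_distrib)
qed

lemma L4_add:
  assumes "L4 X" "L4 Y"
  shows "L4 (\<lambda>\<omega>. X \<omega> + Y \<omega>)"
proof -
  have [measurable]: "X \<in> borel_measurable M" "Y \<in> borel_measurable M"
    using assms by (auto simp: L4_def)
  have meas: "(\<lambda>\<omega>. X \<omega> + Y \<omega>) \<in> borel_measurable M"
    by measurable
  have "integrable M (\<lambda>\<omega>. cmod (X \<omega> + Y \<omega>) ^ 4)"
  proof (rule Bochner_Integration.integrable_bound)
    show "(\<lambda>\<omega>. cmod (X \<omega> + Y \<omega>) ^ 4) \<in> borel_measurable M"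
      by measurable
    show "integrable M (\<lambda>\<omega>. 8 * (cmod (X \<omega>) ^ 4 + cmod (Y \<omega>) ^ 4))"
      using assms by (auto simp: L4_def)
    have "cmod (X \<omega> + Y \<omega>) ^ 4 \<le> 8 * (cmod (X \<omega>) ^ 4 + cmod (Y \<omega>) ^ 4)" for \<omega>
    proof -
      have "cmod (X \<omega> + Y \<omega>) ^ 4 \<le> (cmod (X \<omega>) + cmod (Y \<omega>)) ^ 4"
        by (intro power_mono norm_triangle_ineq) auto
      also have "\<dots> \<le> 8 * (cmod (X \<omega>) ^ 4 + cmod (Y \<omega>) ^ 4)"
        by (intro power4_add_le) auto
      finally show ?thesis .
    qed
    then show "AE \<omega> in M. norm (cmod (X \<omega> + Y \<omega>) ^ 4) \<le> norm (8 * (cmod (X \<omega>) ^ 4 + cmod (Y \<omega>) ^ 4))"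
      by simp
  qed
  with meas show ?thesis
    by (simp add: L4_def)
qed

lemma L4_prod4:
  assumes "L4 X" "L4 Y" "L4 U" "L4 W"
  shows "integrable M (\<lambda>\<omega>. X \<omega> * Y \<omega> * U \<omega> * W \<omega>)"
proof (rule Bochner_Integration.integrable_bound)
  show "integrable M (\<lambda>\<omega>. cmod (X \<omega>) ^ 4 + cmod (Y \<omega>) ^ 4 + cmod (U \<omega>) ^ 4 + cmod (W \<omega>) ^ 4)"
    using assms by (auto simp: L4_def)
  show "(\<lambda>\<omega>. X \<omega> * Y \<omega> * U \<omega> * W \<omega>) \<in> borel_measurable M"
    using assms by (auto simp: L4_def)
  show "AE \<omega> in M. norm (X \<omega> * Y \<omega> * U \<omega> * W \<omega>)
      \<le> norm (cmod (X \<omega>) ^ 4 + cmod (Y \<omega>) ^ 4 + cmod (U \<omega>) ^ 4 + cmod (W \<omega>) ^ 4)"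
    using prod4_le by (simp add: norm_mult)
qed

text \<open>Constants have a finite fourth moment under a probability measure, so shorter products
  are products of four padded with 1.\<close>

lemma L4_prod3:
  "L4 X \<Longrightarrow> L4 Y \<Longrightarrow> L4 U \<Longrightarrow> integrable M (\<lambda>\<omega>. X \<omega> * Y \<omega> * U \<omega>)"
  using L4_prod4[OF _ _ _ L4_const, of X Y U 1] by simp

lemma L4_prod2: "L4 X \<Longrightarrow> L4 Y \<Longrightarrow> integrable M (\<lambda>\<omega>. X \<omega> * Y \<omega>)"
  using L4_prod3[OF _ _ L4_const, of X Y 1] by simp

lemma L4_integrable: "L4 X \<Longrightarrow> integrable M X"
  using L4_prod2[OF _ L4_const, of X 1] by simp

text \<open>No centring takes place: this is the covariance for variables of mean zero, as those
  satisfying \<open>wick\<close> are. It is conjugate-linear in the second argument.\<close>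

definition cov :: "('a \<Rightarrow> complex) \<Rightarrow> ('a \<Rightarrow> complex) \<Rightarrow> complex" where
  "cov X Y = (LINT \<omega>|M. X \<omega> * cnj (Y \<omega>))"

lemma cov_cnj: "cnj (cov X Y) = cov Y X"
  by (simp add: cov_def mult.commute flip: Bochner_Integration.integral_cnj)

lemma cov_add_left: "L4 X \<Longrightarrow> L4 Y \<Longrightarrow> L4 Z \<Longrightarrow> cov (\<lambda>\<omega>. X \<omega> + Y \<omega>) Z = cov X Z + cov Y Z"
  by (simp add: cov_def ring_distribs L4_prod2 L4_cnj)

lemma cov_cmult_left: "cov (\<lambda>\<omega>. c * X \<omega>) Z = c * cov X Z"
  by (simp add: cov_def mult.assoc)

lemma cov_add_right: "L4 X \<Longrightarrow> L4 Y \<Longrightarrow> L4 Z \<Longrightarrow> cov Z (\<lambda>\<omega>. X \<omega> + Y \<omega>) = cov Z X + cov Z Y"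
  by (simp add: cov_def ring_distribs L4_prod2 L4_cnj)

lemma cov_cmult_right: "cov Z (\<lambda>\<omega>. c * X \<omega>) = cnj c * cov Z X"
  by (simp add: cov_def mult.left_commute)

lemma cov_zero_left: "cov (\<lambda>_. 0) Z = 0"
  by (simp add: cov_def)

lemma cov_zero_right: "cov Z (\<lambda>_. 0) = 0"
  by (simp add: cov_def)

lemma L4_sum: "(\<And>i. i \<in> I \<Longrightarrow> L4 (X i)) \<Longrightarrow> L4 (\<lambda>\<omega>. \<Sum>i\<in>I. X i \<omega>)"
  by (induction I rule: infinite_finite_induct) (auto intro: L4_add simp: L4_const)

lemma cov_sum_left:
  "(\<And>i. i \<in> I \<Longrightarrow> L4 (X i)) \<Longrightarrow> L4 Z \<Longrightarrow> cov (\<lambda>\<omega>. \<Sum>i\<in>I. X i \<omega>) Z = (\<Sum>i\<in>I. cov (X i) Z)"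
  by (induction I rule: infinite_finite_induct) (auto simp: cov_add_left L4_sum cov_zero_left)

lemma cov_sum_right:
  "(\<And>i. i \<in> I \<Longrightarrow> L4 (X i)) \<Longrightarrow> L4 Z \<Longrightarrow> cov Z (\<lambda>\<omega>. \<Sum>i\<in>I. X i \<omega>) = (\<Sum>i\<in>I. cov Z (X i))"
  by (induction I rule: infinite_finite_induct) (auto simp: cov_add_right L4_sum cov_zero_right)

text \<open>The part of the circular Gaussian moment structure that survives independent sums and scaling.\<close>

definition wick :: "('a \<Rightarrow> complex) \<Rightarrow> bool" where
  "wick X \<longleftrightarrow> L4 X \<and> (LINT \<omega>|M. X \<omega>) = 0 \<and> (LINT \<omega>|M. X \<omega> * X \<omega>) = 0
     \<and> (LINT \<omega>|M. X \<omega> * X \<omega> * cnj (X \<omega>)) = 0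
     \<and> (LINT \<omega>|M. X \<omega> * X \<omega> * cnj (X \<omega>) * cnj (X \<omega>)) = 2 * (cov X X)\<^sup>2"

lemma wick_zero: "wick (\<lambda>_. 0)"
  by (simp add: wick_def L4_const cov_def)

lemma wick_cmult:
  assumes "wick X"
  shows "wick (\<lambda>\<omega>. c * X \<omega>)"
proof -
  have "(LINT \<omega>|M. c * X \<omega> * (c * X \<omega>)) = c * c * (LINT \<omega>|M. X \<omega> * X \<omega>)"
    by (subst Bochner_Integration.integral_mult_right_zero[symmetric]) (simp add: algebra_simps)
  moreover have "(LINT \<omega>|M. c * X \<omega> * (c * X \<omega>) * cnj (c * X \<omega>))
      = c * c * cnj c * (LINT \<omega>|M. X \<omega> * X \<omega> * cnj (X \<omega>))"
    by (subst Bochner_Integration.integral_mult_right_zero[symmetric]) (simp add: algebra_simps)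
  moreover have "(LINT \<omega>|M. c * X \<omega> * (c * X \<omega>) * cnj (c * X \<omega>) * cnj (c * X \<omega>))
      = c * c * cnj c * cnj c * (LINT \<omega>|M. X \<omega> * X \<omega> * cnj (X \<omega>) * cnj (X \<omega>))"
    by (subst Bochner_Integration.integral_mult_right_zero[symmetric]) (simp add: algebra_simps)
  ultimately show ?thesis
    using assms by (simp add: wick_def L4_cmult cov_cmult_left cov_cmult_right power2_eq_square)
qed

lemma L4_wick: "wick X \<Longrightarrow> L4 X"
  by (simp add: wick_def)

section \<open>Closure of the moment identities under independent sums\<close>

lemma indep_has_integral:
  fixes f g :: "complex \<Rightarrow> complex"
  assumes "indep_var borel X borel Y"
    and "f \<in> borel_measurable borel" "g \<in> borel_measurable borel"
    and "has_bochner_integral M (\<lambda>\<omega>. f (X \<omega>)) a" "has_bochner_integral M (\<lambda>\<omega>. g (Y \<omega>)) b"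
  shows "has_bochner_integral M (\<lambda>\<omega>. f (X \<omega>) * g (Y \<omega>)) (a * b)"
  using indep_var_lebesgue_integral[OF indep_var_compose[OF assms(1-3)]]
    indep_var_integrable[OF indep_var_compose[OF assms(1-3)]] assms(4,5)
  by (simp add: comp_def has_bochner_integral_iff)

text \<open>Stated with \<open>has_bochner_integral\<close> so that integrability and value travel
  together: the integral of a long expansion is then found by applying sum and scaling rules term by
  term.\<close>

lemma has_integral_wick:
  assumes "wick X"
  shows "has_bochner_integral M (\<lambda>\<omega>. X \<omega>) 0"
    and "has_bochner_integral M (\<lambda>\<omega>. cnj (X \<omega>)) 0"
    and "has_bochner_integral M (\<lambda>\<omega>. X \<omega> * X \<omega>) 0"
    and "has_bochner_integral M (\<lambda>\<omega>. cnj (X \<omega>) * cnj (X \<omega>)) 0"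
    and "has_bochner_integral M (\<lambda>\<omega>. X \<omega> * cnj (X \<omega>)) (cov X X)"
    and "has_bochner_integral M (\<lambda>\<omega>. X \<omega> * X \<omega> * cnj (X \<omega>)) 0"
    and "has_bochner_integral M (\<lambda>\<omega>. X \<omega> * cnj (X \<omega>) * cnj (X \<omega>)) 0"
    and "has_bochner_integral M (\<lambda>\<omega>. X \<omega> * X \<omega> * cnj (X \<omega>) * cnj (X \<omega>)) (2 * (cov X X)\<^sup>2)"
proof -
  note L = L4_wick[OF assms] L4_cnj[OF L4_wick[OF assms]]
  note W = assms[unfolded wick_def]
  show 1: "has_bochner_integral M (\<lambda>\<omega>. X \<omega>) 0"
    using W L4_integrable by (simp add: has_bochner_integral_iff)
  show 2: "has_bochner_integral M (\<lambda>\<omega>. X \<omega> * X \<omega>) 0"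
    using W L4_prod2[OF L(1) L(1)] by (simp add: has_bochner_integral_iff)
  show 3: "has_bochner_integral M (\<lambda>\<omega>. X \<omega> * X \<omega> * cnj (X \<omega>)) 0"
    using W L4_prod3[OF L(1) L(1) L(2)] by (simp add: has_bochner_integral_iff)
  show "has_bochner_integral M (\<lambda>\<omega>. X \<omega> * X \<omega> * cnj (X \<omega>) * cnj (X \<omega>)) (2 * (cov X X)\<^sup>2)"
    using W L4_prod4[OF L(1) L(1) L(2) L(2)] by (simp add: has_bochner_integral_iff)
  show "has_bochner_integral M (\<lambda>\<omega>. X \<omega> * cnj (X \<omega>)) (cov X X)"
    using L4_prod2[OF L(1) L(2)] by (simp add: has_bochner_integral_iff cov_def)
  show "has_bochner_integral M (\<lambda>\<omega>. cnj (X \<omega>)) 0"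
    using has_bochner_integral_cnj[OF 1] by simp
  show "has_bochner_integral M (\<lambda>\<omega>. cnj (X \<omega>) * cnj (X \<omega>)) 0"
    using has_bochner_integral_cnj[OF 2] by simp
  show "has_bochner_integral M (\<lambda>\<omega>. X \<omega> * cnj (X \<omega>) * cnj (X \<omega>)) 0"
    using has_bochner_integral_cnj[OF 3] by (simp add: mult.commute mult.left_commute)
qed

lemma cov_indep:
  assumes "indep_var borel X borel Y" "wick X" "wick Y"
  shows "cov X Y = 0"
  using indep_has_integral[OF assms(1), of "\<lambda>x. x" cnj, OF _ borel_measurable_cnj
      has_integral_wick(1)[OF assms(2)] has_integral_wick(2)[OF assms(3)]]
  by (simp add: cov_def has_bochner_integral_iff)

text \<open>After expansion every mixed moment factors by independence, and each one vanishes except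
  that of |X|^2 |Y|^2. In the fourth moment this one has coefficient 4 and completes the square: 2
  x^2 + 4 x y + 2 y^2 = 2 (x + y)^2 for the variances x, y.\<close>

lemma wick_add:
  assumes ind: "indep_var borel X borel Y" and X: "wick X" and Y: "wick Y"
  shows "wick (\<lambda>\<omega>. X \<omega> + Y \<omega>)"
proof -
  note hX = has_integral_wick[OF X] and hY = has_integral_wick[OF Y]
  note add = has_bochner_integral_add and mul = has_bochner_integral_mult_right
  note eq = has_bochner_integral_integral_eq
  have L: "L4 X" "L4 Y"
    using X Y by (auto simp: wick_def)
  have m: "(\<lambda>x::complex. x) \<in> borel_measurable borel" "(\<lambda>x::complex. x * x) \<in> borel_measurable borel"
     "(\<lambda>x::complex. x * cnj x) \<in> borel_measurable borel" "(\<lambda>x::complex. cnj x * cnj x) \<in> borel_measurable borel"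
     "(\<lambda>x::complex. x * x * cnj x) \<in> borel_measurable borel" "(\<lambda>x::complex. x * cnj x * cnj x) \<in> borel_measurable borel"
    by measurable
  note cm = borel_measurable_cnj
  note I = indep_has_integral[OF ind]
  note XY = I[OF m(1) m(1) hX(1) hY(1)]
    I[OF m(2) cm hX(3) hY(2)]
    I[OF m(3) m(1) hX(5) hY(1)]
    I[OF m(1) m(3) hX(1) hY(5)]
    I[OF cm m(2) hX(2) hY(3)]
    I[OF m(5) cm hX(6) hY(2)]
    I[OF m(6) m(1) hX(7) hY(1)]
    I[OF m(2) m(4) hX(3) hY(4)]
    I[OF m(4) m(2) hX(4) hY(3)]
    I[OF m(3) m(3) hX(5) hY(5)]
    I[OF m(1) m(6) hX(1) hY(7)]
    I[OF cm m(5) hX(2) hY(6)]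
  \<comment> \<open>Values such as \<open>0 * 0\<close> collapse to \<open>0\<close>, so that the
    facts unify with the totals written below.\<close>
  note XY = XY[unfolded mult_zero_left mult_zero_right]
  have c0: "cov X Y = 0" "cov Y X = 0"
    using cov_indep[OF ind X Y] cov_cnj[of X Y] by auto
  have 1: "(LINT \<omega>|M. X \<omega> + Y \<omega>) = 0"
    using eq[OF add[OF hX(1) hY(1)]] by simp
  have "has_bochner_integral M (\<lambda>\<omega>. X \<omega> * X \<omega> + 2 * (X \<omega> * Y \<omega>) + Y \<omega> * Y \<omega>) (0 + 2 * 0 + 0)"
    by (rule add mul hX hY XY)+
  from eq[OF this] have 2: "(LINT \<omega>|M. (X \<omega> + Y \<omega>) * (X \<omega> + Y \<omega>)) = 0"
    by (simp add: algebra_simps)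
  have "has_bochner_integral M (\<lambda>\<omega>. X \<omega> * X \<omega> * cnj (X \<omega>) + X \<omega> * X \<omega> * cnj (Y \<omega>)
         + 2 * (X \<omega> * cnj (X \<omega>) * Y \<omega>)
         + 2 * (X \<omega> * (Y \<omega> * cnj (Y \<omega>))) + cnj (X \<omega>) * (Y \<omega> * Y \<omega>) + Y \<omega> * Y \<omega> * cnj (Y \<omega>))
      (0 + 0 + 2 * 0 + 2 * 0 + 0 + 0)"
    by (rule add mul hX hY XY)+
  from eq[OF this] have 3: "(LINT \<omega>|M. (X \<omega> + Y \<omega>) * (X \<omega> + Y \<omega>) * cnj (X \<omega> + Y \<omega>)) = 0"
    by (simp add: algebra_simps)
  have "has_bochner_integral M (\<lambda>\<omega>. X \<omega> * X \<omega> * cnj (X \<omega>) * cnj (X \<omega>)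
         + 2 * (X \<omega> * X \<omega> * cnj (X \<omega>) * cnj (Y \<omega>))
         + 2 * (X \<omega> * cnj (X \<omega>) * cnj (X \<omega>) * Y \<omega>)
         + X \<omega> * X \<omega> * (cnj (Y \<omega>) * cnj (Y \<omega>)) + cnj (X \<omega>) * cnj (X \<omega>) * (Y \<omega> * Y \<omega>)
         + 4 * (X \<omega> * cnj (X \<omega>) * (Y \<omega> * cnj (Y \<omega>)))
         + 2 * (X \<omega> * (Y \<omega> * cnj (Y \<omega>) * cnj (Y \<omega>))) + 2 * (cnj (X \<omega>) * (Y \<omega> * Y \<omega> * cnj (Y \<omega>)))
         + Y \<omega> * Y \<omega> * cnj (Y \<omega>) * cnj (Y \<omega>))
      (2 * (cov X X)\<^sup>2 + 2 * 0 + 2 * 0 + 0 + 0 + 4 * (cov X X * cov Y Y) + 2 * 0 + 2 * 0 + 2 * (cov Y Y)\<^sup>2)"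
    by (rule add mul hX hY XY)+
  from eq[OF this] have "(LINT \<omega>|M. (X \<omega> + Y \<omega>) * (X \<omega> + Y \<omega>) * cnj (X \<omega> + Y \<omega>) * cnj (X \<omega> + Y \<omega>))
      = 2 * (cov X X + cov Y Y)\<^sup>2"
    by (simp add: algebra_simps power2_sum)
  moreover have "cov (\<lambda>\<omega>. X \<omega> + Y \<omega>) (\<lambda>\<omega>. X \<omega> + Y \<omega>) = cov X X + cov Y Y"
    using c0 L by (simp add: cov_add_left cov_add_right L4_add)
  ultimately show ?thesis
    using 1 2 3 L by (simp add: wick_def L4_add)
qed

text \<open>The disjoint index blocks \<open>{i}\<close> and \<open>I\<close> are independent, and
  the sum is a measurable function of its block.\<close>

lemma indep_var_sum_insert:
  fixes X :: "'i \<Rightarrow> 'a \<Rightarrow> complex"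
  assumes I: "finite I" "i \<notin> I" and indep: "indep_vars (\<lambda>_. borel) X (insert i I)"
  shows "indep_var borel (X i) borel (\<lambda>\<omega>. \<Sum>i\<in>I. X i \<omega>)"
proof -
  have "indep_var
    borel ((\<lambda>f. f i) \<circ> (\<lambda>\<omega>. restrict (\<lambda>i. X i \<omega>) {i}))
    borel ((\<lambda>f. \<Sum>i\<in>I. f i) \<circ> (\<lambda>\<omega>. restrict (\<lambda>i. X i \<omega>) I))"
    using I by (intro indep_var_compose[OF indep_var_restrict[OF indep]]) auto
  also have "((\<lambda>f. f i) \<circ> (\<lambda>\<omega>. restrict (\<lambda>i. X i \<omega>) {i})) = X i"
    by auto
  also have "((\<lambda>f. \<Sum>i\<in>I. f i) \<circ> (\<lambda>\<omega>. restrict (\<lambda>i. X i \<omega>) I)) = (\<lambda>\<omega>. \<Sum>i\<in>I. X i \<omega>)"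
    by (auto cong: rev_conj_cong)
  finally show ?thesis .
qed

lemma wick_sum:
  fixes X :: "'i \<Rightarrow> 'a \<Rightarrow> complex"
  assumes "finite I" "indep_vars (\<lambda>_. borel) X I" "\<And>i. i \<in> I \<Longrightarrow> wick (X i)"
  shows "wick (\<lambda>\<omega>. \<Sum>i\<in>I. X i \<omega>)"
  using assms
proof (induction I rule: finite_induct)
  case empty
  show ?case by (simp add: wick_zero)
next
  case (insert i I)
  then show ?case
    using wick_add[OF indep_var_sum_insert[OF insert(1,2,4)]]
      indep_vars_subset[OF insert(4), of I] by auto
qed


text \<open>Stands in for a jointly circular Gaussian family. Independence no longer appears: since
  the moment identities hold for every complex combination, joint moments follow by polarisation
  inside the space.\<close>

definition wick_space :: "('a \<Rightarrow> complex) set \<Rightarrow> bool" where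
  "wick_space H \<longleftrightarrow> (\<forall>X\<in>H. wick X) \<and> (\<forall>X\<in>H. \<forall>Y\<in>H. (\<lambda>\<omega>. X \<omega> + Y \<omega>) \<in> H)
     \<and> (\<forall>X\<in>H. \<forall>c. (\<lambda>\<omega>. c * X \<omega>) \<in> H)"

lemma wick_spaceD:
  assumes "wick_space H"
  shows "X \<in> H \<Longrightarrow> wick X" "X \<in> H \<Longrightarrow> Y \<in> H \<Longrightarrow> (\<lambda>\<omega>. X \<omega> + Y \<omega>) \<in> H"
    "X \<in> H \<Longrightarrow> (\<lambda>\<omega>. c * X \<omega>) \<in> H"
  using assms by (auto simp: wick_space_def)

section \<open>Polarisation and Isserlis' formula\<close>

context
  fixes H assumes H: "wick_space H"
begin

lemma wick_space_L4: "X \<in> H \<Longrightarrow> L4 X"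
  using wick_spaceD(1)[OF H] L4_wick by blast

lemma wick_space_lin: "X \<in> H \<Longrightarrow> Y \<in> H \<Longrightarrow> (\<lambda>\<omega>. X \<omega> + c * Y \<omega>) \<in> H"
  using wick_spaceD(2,3)[OF H] by blast

text \<open>\<open>I\<close> is nonempty because the empty sum is the zero function, which is not in
  \<open>H\<close> when \<open>H\<close> is empty.\<close>

lemma wick_space_sum:
  "(\<And>i. i \<in> I \<Longrightarrow> X i \<in> H) \<Longrightarrow> I \<noteq> {} \<Longrightarrow> finite I \<Longrightarrow> (\<lambda>\<omega>. \<Sum>i\<in>I. X i \<omega>) \<in> H"
proof (induction I rule: infinite_finite_induct)
  case (insert i I)
  then show ?case
    using wick_spaceD(2)[OF H, of "X i" "\<lambda>\<omega>. \<Sum>i\<in>I. X i \<omega>"] by (cases "I = {}") auto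
qed auto

lemma cov_lin:
  assumes "X \<in> H" "Y \<in> H" "Z \<in> H"
  shows "cov (\<lambda>\<omega>. X \<omega> + c * Y \<omega>) Z = cov X Z + c * cov Y Z"
    and "cov Z (\<lambda>\<omega>. X \<omega> + c * Y \<omega>) = cov Z X + cnj c * cov Z Y"
  using assms by (simp_all add: cov_add_left cov_add_right cov_cmult_left cov_cmult_right
      wick_space_L4 L4_cmult)

lemma wick_moment2:
  assumes "X \<in> H" "Y \<in> H"
  shows "has_bochner_integral M (\<lambda>\<omega>. X \<omega> * Y \<omega>) 0"
proof -
  note h = has_integral_wick(3)[OF wick_spaceD(1)[OF H]]
  note diff = has_bochner_integral_diff and mul = has_bochner_integral_mult_right
  have "has_bochner_integral M (\<lambda>\<omega>. (1/2) * ((X \<omega> + Y \<omega>) * (X \<omega> + Y \<omega>) - X \<omega> * X \<omega> - Y \<omega> * Y \<omega>))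
      ((1/2) * (0 - 0 - 0))"
    by (rule diff mul h assms wick_spaceD(2)[OF H])+
  then show ?thesis
    by (simp add: algebra_simps)
qed

lemma wick_moment3:
  assumes "X \<in> H" "Y \<in> H" "U \<in> H"
  shows "has_bochner_integral M (\<lambda>\<omega>. X \<omega> * Y \<omega> * cnj (U \<omega>)) 0"
proof -
  note h = has_integral_wick(6)[OF wick_spaceD(1)[OF H]]
  note diff = has_bochner_integral_diff and add = has_bochner_integral_add
    and mul = has_bochner_integral_mult_right
  \<comment> \<open>Weighting the third moment of X + t U by t and summing over the fourth roots of
    unity leaves only the term carrying \<open>cnj t\<close>, because the other terms pick up t, t^2
    or t^3. The power t^3 is why cube roots would not do.\<close>
  have 1: "has_bochner_integral M (\<lambda>\<omega>. X \<omega> * X \<omega> * cnj (U \<omega>)) 0"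
    if "X \<in> H" "U \<in> H" for X U
  proof -
    let ?T = "\<lambda>t \<omega>. (X \<omega> + t * U \<omega>) * (X \<omega> + t * U \<omega>) * cnj (X \<omega> + t * U \<omega>)"
    have "has_bochner_integral M
       (\<lambda>\<omega>. (1/4) * (?T 1 \<omega> - ?T (-1) \<omega> + \<i> * ?T \<i> \<omega> - \<i> * ?T (-\<i>) \<omega>))
       ((1/4) * (0 - 0 + \<i> * 0 - \<i> * 0))"
      by (rule diff add mul h that wick_space_lin)+
    then show ?thesis
      by (simp add: algebra_simps)
  qed
  \<comment> \<open>The identity (X + Y)^2 - (X - Y)^2 = 4 X Y; the factors \<open>1\<close> and
    \<open>-1\<close> are written out to match \<open>wick_space_lin\<close>.\<close>
  have "has_bochner_integral M
     (\<lambda>\<omega>. (1/4) * ((X \<omega> + 1 * Y \<omega>) * (X \<omega> + 1 * Y \<omega>) * cnj (U \<omega>)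
        - (X \<omega> + (-1) * Y \<omega>) * (X \<omega> + (-1) * Y \<omega>) * cnj (U \<omega>)))
     ((1/4) * (0 - 0))"
    by (rule diff add mul 1 assms wick_space_lin)+
  then show ?thesis
    by (simp add: algebra_simps)
qed

text \<open>Three polarisations in turn: \<open>1\<close> separates the conjugated from the
  unconjugated pair, \<open>2\<close> splits X from Y, and the last step splits U from W.\<close>

lemma wick_moment4:
  assumes "X \<in> H" "Y \<in> H" "U \<in> H" "W \<in> H"
  shows "has_bochner_integral M (\<lambda>\<omega>. X \<omega> * Y \<omega> * cnj (U \<omega>) * cnj (W \<omega>))
    (cov X U * cov Y W + cov X W * cov Y U)"
proof -
  note h = has_integral_wick(8)[OF wick_spaceD(1)[OF H]]
  note diff = has_bochner_integral_diff and add = has_bochner_integral_add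
    and mul = has_bochner_integral_mult_right
  text \<open>Summing \<open>t\<^sup>2 E \<bar>X + t U\<bar>\<^sup>4\<close> over the fourth roots of unity \<open>t\<close> isolates the real part of
    \<open>E (X\<^sup>2 (cnj U)\<^sup>2)\<close>; replacing \<open>X\<close> by \<open>(1 + \<i>) X\<close> then gives the imaginary part.\<close>
  have re: "(LINT \<omega>|M. X \<omega> * X \<omega> * cnj (U \<omega>) * cnj (U \<omega>)) + cnj (LINT \<omega>|M. X \<omega> * X \<omega> * cnj (U \<omega>) * cnj (U \<omega>))
      = 2 * ((cov X U)\<^sup>2 + (cov U X)\<^sup>2)"
    if "X \<in> H" "U \<in> H" for X U
  proof -
    note L = wick_space_L4[OF that(1)] wick_space_L4[OF that(2)]
    let ?f = "\<lambda>\<omega>. X \<omega> * X \<omega> * cnj (U \<omega>) * cnj (U \<omega>)"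
    let ?T = "\<lambda>t \<omega>. (X \<omega> + t * U \<omega>) * (X \<omega> + t * U \<omega>) * cnj (X \<omega> + t * U \<omega>) * cnj (X \<omega> + t * U \<omega>)"
    let ?c = "\<lambda>t. cov (\<lambda>\<omega>. X \<omega> + t * U \<omega>) (\<lambda>\<omega>. X \<omega> + t * U \<omega>)"
    have c: "?c t = cov X X + t * cov U X + cnj t * cov X U + t * cnj t * cov U U" for t
      by (simp add: cov_lin that wick_space_lin algebra_simps)
    have "has_bochner_integral M
       (\<lambda>\<omega>. (1/4) * (?T 1 \<omega> + ?T (-1) \<omega> - ?T \<i> \<omega> - ?T (-\<i>) \<omega>))
       ((1/4) * (2 * (?c 1)\<^sup>2 + 2 * (?c (-1))\<^sup>2 - 2 * (?c \<i>)\<^sup>2 - 2 * (?c (-\<i>))\<^sup>2))"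
      by (rule diff add mul h that wick_space_lin)+
    also have "(1/4) * (2 * (?c 1)\<^sup>2 + 2 * (?c (-1))\<^sup>2 - 2 * (?c \<i>)\<^sup>2 - 2 * (?c (-\<i>))\<^sup>2)
        = 2 * ((cov X U)\<^sup>2 + (cov U X)\<^sup>2)"
      unfolding c by (simp add: power2_eq_square algebra_simps)
    also have "(\<lambda>\<omega>. (1/4) * (?T 1 \<omega> + ?T (-1) \<omega> - ?T \<i> \<omega> - ?T (-\<i>) \<omega>)) = (\<lambda>\<omega>. ?f \<omega> + cnj (?f \<omega>))"
      by (simp add: algebra_simps)
    finally have "has_bochner_integral M (\<lambda>\<omega>. ?f \<omega> + cnj (?f \<omega>)) (2 * ((cov X U)\<^sup>2 + (cov U X)\<^sup>2))" .
    moreover have "integrable M ?f"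
      by (intro L4_prod4 L4_cnj L)
    then have "has_bochner_integral M ?f (integral\<^sup>L M ?f)"
      by (rule has_bochner_integral_integrable)
    from add[OF this has_bochner_integral_cnj[OF this]]
    have "has_bochner_integral M (\<lambda>\<omega>. ?f \<omega> + cnj (?f \<omega>)) (integral\<^sup>L M ?f + cnj (integral\<^sup>L M ?f))" .
    ultimately show ?thesis
      by (rule has_bochner_integral_eq[symmetric])
  qed
  have 1: "has_bochner_integral M (\<lambda>\<omega>. X \<omega> * X \<omega> * cnj (U \<omega>) * cnj (U \<omega>)) (2 * (cov X U)\<^sup>2)"
    if "X \<in> H" "U \<in> H" for X U
  proof -
    note L = wick_space_L4[OF that(1)] wick_space_L4[OF that(2)]
    let ?f = "\<lambda>\<omega>. X \<omega> * X \<omega> * cnj (U \<omega>) * cnj (U \<omega>)"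
    define A where "A = integral\<^sup>L M ?f"
    define r where "r = cov X U"
    have r': "cov U X = cnj r"
      by (simp add: r_def cov_cnj)
    have "(\<lambda>\<omega>. (1 + \<i>) * X \<omega> * ((1 + \<i>) * X \<omega>) * cnj (U \<omega>) * cnj (U \<omega>)) = (\<lambda>\<omega>. 2 * \<i> * ?f \<omega>)"
      by (simp add: fun_eq_iff algebra_simps)
    then have e: "(LINT \<omega>|M. (1 + \<i>) * X \<omega> * ((1 + \<i>) * X \<omega>) * cnj (U \<omega>) * cnj (U \<omega>)) = 2 * \<i> * A"
      by (simp add: A_def)
    have s: "((1 + \<i>) * r)\<^sup>2 = 2 * \<i> * r\<^sup>2" "((1 - \<i>) * cnj r)\<^sup>2 = - 2 * \<i> * (cnj r)\<^sup>2"
      by (simp_all add: power2_eq_square algebra_simps)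
    have 1: "A + cnj A = 2 * (r\<^sup>2 + (cnj r)\<^sup>2)"
      using re[OF that] by (simp add: A_def r_def[symmetric] r')
    have "2 * \<i> * A + cnj (2 * \<i> * A) = 2 * (((1 + \<i>) * r)\<^sup>2 + ((1 - \<i>) * cnj r)\<^sup>2)"
      using re[OF wick_spaceD(3)[OF H that(1), of "1 + \<i>"] that(2)]
      unfolding e by (simp add: cov_cmult_left cov_cmult_right r_def[symmetric] r')
    then have "2 * \<i> * (A - cnj A) = 2 * \<i> * (2 * (r\<^sup>2 - (cnj r)\<^sup>2))"
      unfolding s by (simp add: algebra_simps)
    then have "A - cnj A = 2 * (r\<^sup>2 - (cnj r)\<^sup>2)"
      by simp
    from arg_cong2[of _ _ _ _ "(+)", OF this 1] have "2 * A = 4 * r\<^sup>2"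
      by (simp add: algebra_simps)
    then have "A = 2 * r\<^sup>2"
      by simp
    moreover have "integrable M ?f"
      by (intro L4_prod4 L4_cnj L)
    ultimately show ?thesis
      by (simp add: has_bochner_integral_iff A_def r_def)
  qed
  have 2: "has_bochner_integral M (\<lambda>\<omega>. X \<omega> * Y \<omega> * cnj (U \<omega>) * cnj (U \<omega>)) (2 * cov X U * cov Y U)"
    if "X \<in> H" "Y \<in> H" "U \<in> H" for X Y U
  proof -
    have "has_bochner_integral M
     (\<lambda>\<omega>. (1/4) * ((X \<omega> + 1 * Y \<omega>) * (X \<omega> + 1 * Y \<omega>) * cnj (U \<omega>) * cnj (U \<omega>)
        - (X \<omega> + (-1) * Y \<omega>) * (X \<omega> + (-1) * Y \<omega>) * cnj (U \<omega>) * cnj (U \<omega>)))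
     ((1/4) * (2 * (cov (\<lambda>\<omega>. X \<omega> + 1 * Y \<omega>) U)\<^sup>2 - 2 * (cov (\<lambda>\<omega>. X \<omega> + (-1) * Y \<omega>) U)\<^sup>2))"
      by (rule diff add mul 1 that wick_space_lin)+
    then show ?thesis
      unfolding cov_lin[OF that] by (simp add: algebra_simps power2_eq_square)
  qed
  \<comment> \<open>Polarising in the conjugated pair turns the single product of \<open>2\<close>
    into the sum over both pairings: (x + x') (y + y') - (x - x') (y - y') = 2 (x y' + x'
    y).\<close>
  have "has_bochner_integral M
     (\<lambda>\<omega>. (1/4) * (X \<omega> * Y \<omega> * cnj (U \<omega> + 1 * W \<omega>) * cnj (U \<omega> + 1 * W \<omega>)
        - X \<omega> * Y \<omega> * cnj (U \<omega> + (-1) * W \<omega>) * cnj (U \<omega> + (-1) * W \<omega>)))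
     ((1/4) * (2 * cov X (\<lambda>\<omega>. U \<omega> + 1 * W \<omega>) * cov Y (\<lambda>\<omega>. U \<omega> + 1 * W \<omega>)
         - 2 * cov X (\<lambda>\<omega>. U \<omega> + (-1) * W \<omega>) * cov Y (\<lambda>\<omega>. U \<omega> + (-1) * W \<omega>)))"
    by (rule diff add mul 2 assms wick_space_lin)+
  then show ?thesis
    unfolding cov_lin(2)[OF assms(3,4,1)] cov_lin(2)[OF assms(3,4,2)]
    by (simp add: algebra_simps)
qed

text \<open>Of the sixteen terms of the expansion, those of odd order and those with unequally many
  conjugated and plain fluctuations vanish. Isserlis splits the quartic term in two; the pairing
  \<open>cov e' h' * cov h e\<close> is exactly what completes the product of the two full
  means.\<close>

lemma bilinear_pair:
  assumes "e \<in> H" "h \<in> H" "e' \<in> H" "h' \<in> H"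
  shows "has_bochner_integral M
     (\<lambda>\<omega>. cnj (a + e \<omega>) * (b + h \<omega>) * cnj (cnj (a' + e' \<omega>) * (b' + h' \<omega>)))
     ((cnj a * b + cov h e) * cnj (cnj a' * b' + cov h' e') + cnj a * a' * cov h h'
       + b * cnj b' * cov e' e + cov e' e * cov h h')"
proof -
  note add = has_bochner_integral_add and mul = has_bochner_integral_mult_right
  note w = has_integral_wick[OF wick_spaceD(1)[OF H]]
  have c: "has_bochner_integral M (\<lambda>\<omega>. c) c" for c :: complex
    by (simp add: has_bochner_integral_iff prob_space)
  have c2: "has_bochner_integral M (\<lambda>\<omega>. cnj (X \<omega>) * cnj (Y \<omega>)) 0" if "X \<in> H" "Y \<in> H" for X Y
    using has_bochner_integral_cnj[OF wick_moment2[OF that]] by simp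
  have c3: "has_bochner_integral M (\<lambda>\<omega>. X \<omega> * cnj (Y \<omega>) * cnj (U \<omega>)) 0" if "X \<in> H" "Y \<in> H" "U \<in> H" for X Y U
    using has_bochner_integral_cnj[OF wick_moment3[OF that(2,3,1)]] by (simp add: mult_ac)
  have s: "has_bochner_integral M (\<lambda>\<omega>. X \<omega> * cnj (Y \<omega>)) (cov X Y)" if "X \<in> H" "Y \<in> H" for X Y
    using L4_prod2[OF wick_space_L4[OF that(1)] L4_cnj[OF wick_space_L4[OF that(2)]]]
    by (simp add: has_bochner_integral_iff cov_def)
  have "has_bochner_integral M
     (\<lambda>\<omega>. cnj a * b * a' * cnj b' + cnj a * b * a' * cnj (h' \<omega>) + cnj a * b * cnj b' * e' \<omega>
       + cnj a * b * (e' \<omega> * cnj (h' \<omega>))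
       + cnj a * a' * cnj b' * h \<omega> + cnj a * a' * (h \<omega> * cnj (h' \<omega>)) + cnj a * cnj b' * (e' \<omega> * h \<omega>)
       + cnj a * (e' \<omega> * h \<omega> * cnj (h' \<omega>))
       + b * a' * cnj b' * cnj (e \<omega>) + b * a' * (cnj (e \<omega>) * cnj (h' \<omega>)) + b * cnj b' * (e' \<omega> * cnj (e \<omega>))
       + b * (e' \<omega> * cnj (e \<omega>) * cnj (h' \<omega>))
       + a' * cnj b' * (h \<omega> * cnj (e \<omega>)) + a' * (h \<omega> * cnj (e \<omega>) * cnj (h' \<omega>))
       + cnj b' * (e' \<omega> * h \<omega> * cnj (e \<omega>)) + e' \<omega> * h \<omega> * cnj (e \<omega>) * cnj (h' \<omega>))
     (cnj a * b * a' * cnj b' + cnj a * b * a' * 0 + cnj a * b * cnj b' * 0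
       + cnj a * b * cov e' h'
       + cnj a * a' * cnj b' * 0 + cnj a * a' * cov h h' + cnj a * cnj b' * 0
       + cnj a * 0
       + b * a' * cnj b' * 0 + b * a' * 0 + b * cnj b' * cov e' e
       + b * 0
       + a' * cnj b' * cov h e + a' * 0
       + cnj b' * 0 + (cov e' e * cov h h' + cov e' h' * cov h e))"
    by (rule add mul w(1,2) c2 c3 s wick_moment2 wick_moment3 wick_moment4 assms c)+
  then show ?thesis
    by (simp add: algebra_simps cov_cnj)
qed

lemma bilinear_mean:
  assumes "\<And>i. i \<in> I \<Longrightarrow> e i \<in> H" "\<And>i. i \<in> I \<Longrightarrow> h i \<in> H"
  shows "has_bochner_integral M (\<lambda>\<omega>. \<Sum>i\<in>I. cnj (a i + e i \<omega>) * (b i + h i \<omega>))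
    (\<Sum>i\<in>I. cnj (a i) * b i + cov (h i) (e i))"
proof (rule has_bochner_integral_sum)
  fix i assume i: "i \<in> I"
  note add = has_bochner_integral_add and mul = has_bochner_integral_mult_right
  note w = has_integral_wick[OF wick_spaceD(1)[OF H]]
  have c: "has_bochner_integral M (\<lambda>\<omega>. c) c" for c :: complex
    by (simp add: has_bochner_integral_iff prob_space)
  have s: "has_bochner_integral M (\<lambda>\<omega>. h i \<omega> * cnj (e i \<omega>)) (cov (h i) (e i))"
    using L4_prod2[OF wick_space_L4[OF assms(2)] L4_cnj[OF wick_space_L4[OF assms(1)]]] i
    by (simp add: has_bochner_integral_iff cov_def)
  have "has_bochner_integral M
      (\<lambda>\<omega>. cnj (a i) * b i + cnj (a i) * h i \<omega> + b i * cnj (e i \<omega>) + h i \<omega> * cnj (e i \<omega>))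
      (cnj (a i) * b i + cnj (a i) * 0 + b i * 0 + cov (h i) (e i))"
    by (rule add mul s w(1,2) assms i c)+
  then show "has_bochner_integral M (\<lambda>\<omega>. cnj (a i + e i \<omega>) * (b i + h i \<omega>))
      (cnj (a i) * b i + cov (h i) (e i))"
    by (simp add: algebra_simps)
qed

text \<open>|z|^2 is the double sum of z_i times conjugated z_j, so \<open>bilinear_pair\<close>
  applies to each pair; the products of means recombine into the squared modulus of the total
  mean.\<close>

lemma bilinear_second_moment:
  assumes "\<And>i. i \<in> I \<Longrightarrow> e i \<in> H" "\<And>i. i \<in> I \<Longrightarrow> h i \<in> H"
  shows "complex_of_real (LINT \<omega>|M. (cmod (\<Sum>i\<in>I. cnj (a i + e i \<omega>) * (b i + h i \<omega>)))\<^sup>2)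
    = complex_of_real ((cmod (\<Sum>i\<in>I. cnj (a i) * b i + cov (h i) (e i)))\<^sup>2)
      + (\<Sum>i\<in>I. \<Sum>j\<in>I. cnj (a i) * a j * cov (h i) (h j))
      + (\<Sum>i\<in>I. \<Sum>j\<in>I. b i * cnj (b j) * cov (e j) (e i))
      + (\<Sum>i\<in>I. \<Sum>j\<in>I. cov (e j) (e i) * cov (h i) (h j))"
proof -
  let ?z = "\<lambda>i \<omega>. cnj (a i + e i \<omega>) * (b i + h i \<omega>)"
  let ?m = "\<lambda>i. cnj (a i) * b i + cov (h i) (e i)"
  have "complex_of_real (LINT \<omega>|M. (cmod (\<Sum>i\<in>I. ?z i \<omega>))\<^sup>2)
      = (LINT \<omega>|M. complex_of_real ((cmod (\<Sum>i\<in>I. ?z i \<omega>))\<^sup>2))"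
    by (rule integral_complex_of_real[symmetric])
  also have "\<dots> = (LINT \<omega>|M. (\<Sum>i\<in>I. \<Sum>j\<in>I. ?z i \<omega> * cnj (?z j \<omega>)))"
    unfolding complex_norm_square cnj_sum sum_product ..
  also have "\<dots> = (\<Sum>i\<in>I. \<Sum>j\<in>I. ?m i * cnj (?m j) + cnj (a i) * a j * cov (h i) (h j)
       + b i * cnj (b j) * cov (e j) (e i) + cov (e j) (e i) * cov (h i) (h j))"
    by (intro has_bochner_integral_integral_eq has_bochner_integral_sum bilinear_pair assms)
  also have "\<dots> = (\<Sum>i\<in>I. \<Sum>j\<in>I. ?m i * cnj (?m j))
      + (\<Sum>i\<in>I. \<Sum>j\<in>I. cnj (a i) * a j * cov (h i) (h j))
      + (\<Sum>i\<in>I. \<Sum>j\<in>I. b i * cnj (b j) * cov (e j) (e i))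
      + (\<Sum>i\<in>I. \<Sum>j\<in>I. cov (e j) (e i) * cov (h i) (h j))"
    by (simp only: sum.distrib)
  also have "(\<Sum>i\<in>I. \<Sum>j\<in>I. ?m i * cnj (?m j)) = complex_of_real ((cmod (\<Sum>i\<in>I. ?m i))\<^sup>2)"
    unfolding complex_norm_square cnj_sum sum_product ..
  finally show ?thesis .
qed

end

section \<open>From Gaussian densities to moment identities\<close>

lemma normal_distributed_moments:
  fixes X :: "'a \<Rightarrow> real"
  assumes D: "distributed M lborel X (\<lambda>x. ennreal (normal_density 0 \<sigma> x))" and "0 < \<sigma>"
  shows "has_bochner_integral M (\<lambda>\<omega>. X \<omega>) 0"
    and "has_bochner_integral M (\<lambda>\<omega>. (X \<omega>)\<^sup>2) (\<sigma>\<^sup>2)"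
    and "has_bochner_integral M (\<lambda>\<omega>. X \<omega> ^ 3) 0"
    and "has_bochner_integral M (\<lambda>\<omega>. X \<omega> ^ 4) (3 * \<sigma> ^ 4)"
proof -
  have t: "has_bochner_integral M (\<lambda>\<omega>. X \<omega> ^ n) c"
    if "has_bochner_integral lborel (\<lambda>x. normal_density 0 \<sigma> x * x ^ n) c" for n c
    using that distributed_integral[OF D, of "\<lambda>x. x ^ n"] distributed_integrable[OF D, of "\<lambda>x. x ^ n"]
    by (simp add: has_bochner_integral_iff)
  show "has_bochner_integral M (\<lambda>\<omega>. X \<omega>) 0"
    using t[of 1 0] normal_moment_odd[OF assms(2), of 0 0] by simp
  show "has_bochner_integral M (\<lambda>\<omega>. X \<omega> ^ 3) 0"
    using t[of 3 0] normal_moment_odd[OF assms(2), of 0 1] by (simp add: numeral_3_eq_3)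
  show "has_bochner_integral M (\<lambda>\<omega>. (X \<omega>)\<^sup>2) (\<sigma>\<^sup>2)"
    using t[of 2 "\<sigma>\<^sup>2"] normal_moment_even[OF assms(2), of 0 1] by (simp add: fact_numeral)
  \<comment> \<open>The left side is the general even-moment formula at order 2 * 2.\<close>
  have "fact 4 / ((2 / \<sigma>\<^sup>2)\<^sup>2 * fact 2) = 3 * \<sigma> ^ 4"
    using assms(2) by (simp add: fact_numeral power_divide field_simps)
  then show "has_bochner_integral M (\<lambda>\<omega>. X \<omega> ^ 4) (3 * \<sigma> ^ 4)"
    using t[of 4 "3 * \<sigma> ^ 4"] normal_moment_even[OF assms(2), of 0 2] by simp
qed

text \<open>The only place where the densities are used. The degenerate case is separate because
  there \<open>cgauss\<close> gives vanishing almost everywhere instead of a density.\<close>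

lemma cgauss_wick:
  assumes "cgauss M X v"
  shows "wick X" "cov X X = complex_of_real v"
proof -
  have [measurable]: "X \<in> borel_measurable M"
    using assms by (simp add: cgauss_def)
  have "wick X \<and> cov X X = complex_of_real v"
  proof (cases "v = 0")
    case True
    then have AE: "AE \<omega> in M. X \<omega> = 0"
      using assms by (simp add: cgauss_def)
    have z: "(LINT \<omega>|M. f \<omega>) = 0" if "f \<in> borel_measurable M" "\<And>\<omega>. X \<omega> = 0 \<Longrightarrow> f \<omega> = 0"
      for f :: "'a \<Rightarrow> complex"
    proof -
      have "(LINT \<omega>|M. f \<omega>) = (LINT \<omega>|M. 0)"
        using AE that by (intro integral_cong_AE) auto
      then show ?thesis by simp
    qed
    have "integrable M (\<lambda>\<omega>. cmod (X \<omega>) ^ 4) \<longleftrightarrow> integrable M (\<lambda>\<omega>. 0 :: real)"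
      using AE by (intro integrable_cong_AE) auto
    then have "L4 X"
      by (simp add: L4_def)
    moreover have "cov X X = 0"
      unfolding cov_def by (rule z) auto
    ultimately show ?thesis
      unfolding wick_def using True by (auto intro!: z)
  next
    case False
    define s where "s = sqrt (v / 2)"
    from False assms have v: "0 < v"
      and D: "distributed M lborel (\<lambda>\<omega>. Re (X \<omega>)) (\<lambda>x. ennreal (normal_density 0 s x))"
        "distributed M lborel (\<lambda>\<omega>. Im (X \<omega>)) (\<lambda>x. ennreal (normal_density 0 s x))"
      and ind: "indep_var borel (\<lambda>\<omega>. Re (X \<omega>)) borel (\<lambda>\<omega>. Im (X \<omega>))"
      by (auto simp: cgauss_def s_def)
    have s: "0 < s" "s\<^sup>2 = v / 2"
      using v by (auto simp: s_def)
    have s4: "s ^ 4 = v\<^sup>2 / 4"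
    proof -
      have "s ^ 4 = (s\<^sup>2)\<^sup>2" by simp
      also have "\<dots> = v\<^sup>2 / 4" unfolding s(2) by (simp add: power_divide)
      finally show ?thesis .
    qed
    note mR = normal_distributed_moments[OF D(1) s(1), unfolded s s4]
    note mI = normal_distributed_moments[OF D(2) s(1), unfolded s s4]
    have P: "has_bochner_integral M (\<lambda>\<omega>. Re (X \<omega>) ^ i * Im (X \<omega>) ^ j) (a * b)"
      if "has_bochner_integral M (\<lambda>\<omega>. Re (X \<omega>) ^ i) a" "has_bochner_integral M (\<lambda>\<omega>. Im (X \<omega>) ^ j) b"
      for i j a b
    proof -
      have "indep_var borel ((\<lambda>x. x ^ i) \<circ> (\<lambda>\<omega>. Re (X \<omega>))) borel ((\<lambda>x. x ^ j) \<circ> (\<lambda>\<omega>. Im (X \<omega>)))"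
        by (rule indep_var_compose[OF ind]) auto
      from indep_var_lebesgue_integral[OF this] indep_var_integrable[OF this] that
      show ?thesis
        by (simp add: comp_def has_bochner_integral_iff)
    qed
    note m = mR mI P[of 1 _ 1, unfolded power_one_right, OF mR(1) mI(1)]
      P[of 2 _ 1, unfolded power_one_right, OF mR(2) mI(1)]
      P[of 1 _ 2, unfolded power_one_right, OF mR(1) mI(2)]
      P[OF mR(2) mI(2)]
    note o = has_bochner_integral_of_real
    note add = has_bochner_integral_add and mul = has_bochner_integral_mult_right
      and diff = has_bochner_integral_diff
    \<comment> \<open>Real and imaginary part each have variance v / 2, so the total is 3 v^2 / 4 +
      2 v^2 / 4 + 3 v^2 / 4 = 2 v^2: the origin of the factor 2 in \<open>wick\<close>.\<close>
    have r4: "has_bochner_integral M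
        (\<lambda>\<omega>. Re (X \<omega>) ^ 4 + 2 * ((Re (X \<omega>))\<^sup>2 * (Im (X \<omega>))\<^sup>2) + Im (X \<omega>) ^ 4)
        (3 * (v\<^sup>2 / 4) + 2 * (v / 2 * (v / 2)) + 3 * (v\<^sup>2 / 4))"
      by (rule add mul m)+
    have n4: "cmod x ^ 4 = Re x ^ 4 + 2 * ((Re x)\<^sup>2 * (Im x)\<^sup>2) + Im x ^ 4" for x
    proof -
      have "cmod x ^ 4 = ((cmod x)\<^sup>2)\<^sup>2" by simp
      then show ?thesis by (simp add: cmod_power2 power2_sum)
    qed
    have L: "L4 X"
      using r4 by (simp add: L4_def n4 has_bochner_integral_iff)
    have c1: "has_bochner_integral M (\<lambda>\<omega>. of_real (Re (X \<omega>)) + \<i> * of_real (Im (X \<omega>)))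
        (of_real 0 + \<i> * of_real 0)"
      by (rule add mul o m)+
    have c2: "has_bochner_integral M (\<lambda>\<omega>. of_real ((Re (X \<omega>))\<^sup>2) - of_real ((Im (X \<omega>))\<^sup>2)
          + 2 * \<i> * of_real (Re (X \<omega>) * Im (X \<omega>)))
        (of_real (v / 2) - of_real (v / 2) + 2 * \<i> * of_real (0 * 0))"
      by (rule add mul diff o m)+
    have c11: "has_bochner_integral M (\<lambda>\<omega>. of_real ((Re (X \<omega>))\<^sup>2) + of_real ((Im (X \<omega>))\<^sup>2))
        (of_real (v / 2) + of_real (v / 2) :: complex)"
      by (rule add mul diff o m)+
    have c21: "has_bochner_integral M (\<lambda>\<omega>. of_real (Re (X \<omega>) ^ 3) + of_real (Re (X \<omega>) * (Im (X \<omega>))\<^sup>2)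
          + \<i> * of_real (Im (X \<omega>) ^ 3) + \<i> * of_real ((Re (X \<omega>))\<^sup>2 * Im (X \<omega>)))
        (of_real 0 + of_real (0 * (v / 2)) + \<i> * of_real 0 + \<i> * of_real (v / 2 * 0))"
      by (rule add mul diff o m)+
    have e: "x * x = of_real ((Re x)\<^sup>2) - of_real ((Im x)\<^sup>2) + 2 * \<i> * of_real (Re x * Im x)"
      "x * cnj x = of_real ((Re x)\<^sup>2) + of_real ((Im x)\<^sup>2)"
      "x * x * cnj x = of_real (Re x ^ 3) + of_real (Re x * (Im x)\<^sup>2)
          + \<i> * of_real (Im x ^ 3) + \<i> * of_real ((Re x)\<^sup>2 * Im x)"
      "x * x * cnj x * cnj x = of_real (Re x ^ 4 + 2 * ((Re x)\<^sup>2 * (Im x)\<^sup>2) + Im x ^ 4)" for x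
      by (simp_all add: complex_eq_iff power2_eq_square power3_eq_cube power4_eq_xxxx algebra_simps)
    have cv: "cov X X = of_real v"
      using c11 by (simp add: cov_def e(2) has_bochner_integral_iff)
    have "wick X"
      unfolding wick_def
    proof (intro conjI L)
      show "(LINT \<omega>|M. X \<omega>) = 0"
        using c1 by (simp add: has_bochner_integral_iff complex_eq[symmetric])
      show "(LINT \<omega>|M. X \<omega> * X \<omega>) = 0"
        using c2 by (simp only: e(1)) (simp add: has_bochner_integral_iff)
      show "(LINT \<omega>|M. X \<omega> * X \<omega> * cnj (X \<omega>)) = 0"
        using c21 by (simp only: e(3)) (simp add: has_bochner_integral_iff)
      show "(LINT \<omega>|M. X \<omega> * X \<omega> * cnj (X \<omega>) * cnj (X \<omega>)) = 2 * (cov X X)\<^sup>2"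
        using has_bochner_integral_integral_eq[OF r4]
        by (simp only: e(4) integral_complex_of_real cv) (simp add: power2_eq_square)
    qed
    with cv show ?thesis by simp
  qed
  then show "wick X" "cov X X = complex_of_real v" by auto
qed

end

section \<open>Families of independent Gaussian vectors\<close>

lemma hip_add_left: "hip (a + b) x = hip a x + hip b x"
  by (simp add: hip_def ring_distribs sum.distrib)

lemma hip_scale_left: "hip (c *s a) x = cnj c * hip a x"
  by (simp add: hip_def sum_distrib_left mult_ac)

lemma hip_add_right: "hip a (x + y) = hip a x + hip a y"
  by (simp add: hip_def ring_distribs sum.distrib)

lemma hip_zero_left: "hip 0 x = 0"
  by (simp add: hip_def)

lemma hip_axis_left: "hip (axis i 1) x = x $ i"
proof -
  have "hip (axis i 1) x = (\<Sum>j\<in>UNIV. if j = i then x $ j else 0)"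
    unfolding hip_def by (intro sum.cong) (auto simp: axis_def)
  then show ?thesis by simp
qed

lemma hip_self: "hip a a = complex_of_real ((norm a)\<^sup>2)"
proof -
  have "(norm a)\<^sup>2 = (\<Sum>i\<in>UNIV. (cmod (a $ i))\<^sup>2)"
    by (simp add: norm_vec_def L2_set_def sum_nonneg)
  then show ?thesis
    by (simp only: of_real_sum complex_norm_square hip_def mult.commute)
qed

lemma matrix_vector_axis: "((A :: complex^'n^'m) *v axis j 1) $ i = A $ i $ j"
proof -
  have "((A :: complex^'n^'m) *v axis j 1) $ i = (\<Sum>l\<in>UNIV. if l = j then A $ i $ l else 0)"
    unfolding matrix_vector_mult_def vec_lambda_beta by (intro sum.cong) (auto simp: axis_def)
  then show ?thesis by simp
qed

lemma hip_matrix_vector: "hip a (A *v b) = (\<Sum>i\<in>UNIV. \<Sum>j\<in>UNIV. cnj (a $ i) * b $ j * A $ i $ j)"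
  by (simp add: hip_def matrix_vector_mult_def sum_distrib_left mult_ac)

lemma borel_measurable_hip [measurable]: "hip a \<in> borel_measurable borel"
  unfolding hip_def by (intro borel_measurable_continuous_onI continuous_intros)

lemma hermitian_psd_cnj: "hermitian_psd R \<Longrightarrow> cnj (R $ i $ j) = R $ j $ i"
  unfolding hermitian_psd_def by metis

text \<open>\<open>cgauss_vec\<close> records variances through \<open>Re\<close>; for a Hermitian
  matrix nothing is lost by this.\<close>

lemma hip_hermitian_real:
  assumes "\<And>i j. cnj (R $ i $ j) = R $ j $ i"
  shows "complex_of_real (Re (hip a (R *v a))) = hip a (R *v a)"
proof -
  have "cnj (hip a (R *v a)) = hip a (R *v a)"
    unfolding hip_matrix_vector by (simp add: assms) (subst sum.swap, simp add: mult_ac)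
  then show ?thesis
    by (simp add: complex_eq_iff)
qed

context prob_space
begin

text \<open>The definition supplies only variances of linear functionals. Those of Y_i +
  \<open>cnj t\<close> Y_j for t = 1 and t = \<i> give the sum and the difference of the two
  cross-covariances, hence each of them.\<close>

lemma cgauss_vec_component:
  fixes X :: "'a \<Rightarrow> complex^'n"
  assumes G: "cgauss_vec M X mu R" and R: "\<And>i j. cnj (R $ i $ j) = R $ j $ i"
  shows "cov (\<lambda>\<omega>. X \<omega> $ i - mu $ i) (\<lambda>\<omega>. X \<omega> $ j - mu $ j) = R $ i $ j"
proof -
  define Y where "Y = (\<lambda>i \<omega>. X \<omega> $ i - mu $ i)"
  have g: "cgauss M (\<lambda>\<omega>. hip a (X \<omega> - mu)) (Re (hip a (R *v a)))" for a
    using G by (simp add: cgauss_vec_def)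
  have v: "cov (\<lambda>\<omega>. hip a (X \<omega> - mu)) (\<lambda>\<omega>. hip a (X \<omega> - mu)) = hip a (R *v a)" for a
    using cgauss_wick(2)[OF g[of a]] hip_hermitian_real[OF R] by simp
  have L: "L4 (Y i)" for i
    using L4_wick[OF cgauss_wick(1)[OF g[of "axis i 1"]]] by (simp add: hip_axis_left Y_def)
  have h: "hip (axis i 1 + t *s axis j 1) x = x $ i + cnj t * x $ j" for t and x :: "complex^'n"
    by (simp add: hip_add_left hip_scale_left hip_axis_left)
  have c: "cov (Y i) (Y i) + t * cov (Y i) (Y j) + cnj t * cov (Y j) (Y i) + cnj t * t * cov (Y j) (Y j)
     = R $ i $ i + t * R $ i $ j + cnj t * R $ j $ i + cnj t * t * R $ j $ j" for t
  proof -
    have "cov (\<lambda>\<omega>. Y i \<omega> + cnj t * Y j \<omega>) (\<lambda>\<omega>. Y i \<omega> + cnj t * Y j \<omega>)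
        = hip (axis i 1 + t *s axis j 1) (R *v (axis i 1 + t *s axis j 1))"
      using v[of "axis i 1 + t *s axis j 1"] by (simp only: h Y_def vector_minus_component)
    also have "\<dots> = R $ i $ i + t * R $ i $ j + cnj t * R $ j $ i + cnj t * t * R $ j $ j"
      by (simp add: h matrix_vector_right_distrib vector_scalar_commute
           matrix_vector_axis algebra_simps)
    finally show ?thesis
      using L by (simp add: cov_add_left cov_add_right cov_cmult_left cov_cmult_right L4_add L4_cmult algebra_simps)
  qed
  have d: "cov (Y i) (Y i) = R $ i $ i" for i
    using cgauss_wick(2)[OF g[of "axis i 1"]] v[of "axis i 1"]
    by (simp add: hip_axis_left matrix_vector_axis Y_def)
  have "cov (Y i) (Y j) + cov (Y j) (Y i) = R $ i $ j + R $ j $ i"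
    using c[of 1] by (simp add: d)
  moreover have "\<i> * (cov (Y i) (Y j) - cov (Y j) (Y i)) = \<i> * (R $ i $ j - R $ j $ i)"
    using c[of \<i>] by (simp add: d algebra_simps)
  then have "cov (Y i) (Y j) - cov (Y j) (Y i) = R $ i $ j - R $ j $ i"
    by simp
  ultimately have "2 * cov (Y i) (Y j) = 2 * R $ i $ j"
    by (smt (verit) add_diff_cancel_left' add_diff_eq diff_add_cancel mult_2 add.commute)
  then show ?thesis by (simp add: Y_def)
qed

lemma indep_var_pair:
  assumes "indep_vars (\<lambda>_. N) Y J" "i \<in> J" "j \<in> J" "i \<noteq> j"
  shows "indep_var N (Y i) N (Y j)"
proof -
  have "indep_var N ((\<lambda>f. f i) \<circ> (\<lambda>\<omega>. restrict (\<lambda>i. Y i \<omega>) {i})) N ((\<lambda>f. f j) \<circ> (\<lambda>\<omega>. restrict (\<lambda>i. Y i \<omega>) {j}))"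
    using assms by (intro indep_var_compose[OF indep_var_restrict[OF assms(1)]]) auto
  then show ?thesis
    by (simp add: comp_def)
qed

text \<open>The space is the set of all linear functionals of the whole family. Each is a sum of
  independent scalars, so \<open>wick_sum\<close> applies; closure holds because \<open>hip\<close>
  is additive and conjugate-homogeneous on the left, hence the coefficient
  \<open>cnj c\<close>.\<close>

lemma wick_space_indep:
  fixes Y :: "'i \<Rightarrow> 'a \<Rightarrow> complex^'n"
  assumes J: "finite J" and ind: "indep_vars (\<lambda>_. borel) Y J"
    and W: "\<And>i a. i \<in> J \<Longrightarrow> wick (\<lambda>\<omega>. hip a (Y i \<omega>))"
  shows "\<exists>H. wick_space H \<and> (\<forall>i\<in>J. \<forall>j. (\<lambda>\<omega>. Y i \<omega> $ j) \<in> H)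
    \<and> (\<forall>i\<in>J. \<forall>i'\<in>J. i \<noteq> i' \<longrightarrow> (\<forall>j j'. cov (\<lambda>\<omega>. Y i \<omega> $ j) (\<lambda>\<omega>. Y i' \<omega> $ j') = 0))"
proof -
  define L where "L = (\<lambda>a \<omega>. \<Sum>i\<in>J. hip (a i) (Y i \<omega>))"
  have w: "wick (L a)" for a
    unfolding L_def
    by (rule wick_sum[OF J indep_vars_compose2[OF ind]]) (auto intro: W)
  have "wick_space (range L)"
    unfolding wick_space_def
  proof (intro conjI ballI allI)
    show "wick X" if "X \<in> range L" for X
      using that w by auto
    fix X c assume X: "X \<in> range L"
    then obtain a where a: "X = L a" by auto
    have "(\<lambda>\<omega>. c * X \<omega>) = L (\<lambda>i. cnj c *s a i)"
      by (simp add: a L_def hip_scale_left sum_distrib_left)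
    then show "(\<lambda>\<omega>. c * X \<omega>) \<in> range L" by auto
    fix Z assume "Z \<in> range L"
    then obtain b where b: "Z = L b" by auto
    have "(\<lambda>\<omega>. X \<omega> + Z \<omega>) = L (\<lambda>i. a i + b i)"
      by (simp add: a b L_def hip_add_left sum.distrib)
    then show "(\<lambda>\<omega>. X \<omega> + Z \<omega>) \<in> range L" by auto
  qed
  moreover have "(\<lambda>\<omega>. Y i \<omega> $ j) \<in> range L" if "i \<in> J" for i j
  proof -
    have "L (\<lambda>i'. if i' = i then axis j 1 else 0) \<omega> = (\<Sum>i'\<in>J. if i' = i then Y i' \<omega> $ j else 0)" for \<omega>
      unfolding L_def by (intro sum.cong) (auto simp: hip_axis_left hip_zero_left)
    then have "(\<lambda>\<omega>. Y i \<omega> $ j) = L (\<lambda>i'. if i' = i then axis j 1 else 0)"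
      using that J by (simp add: fun_eq_iff)
    then show ?thesis by auto
  qed
  moreover have "cov (\<lambda>\<omega>. Y i \<omega> $ j) (\<lambda>\<omega>. Y i' \<omega> $ j') = 0" if "i \<in> J" "i' \<in> J" "i \<noteq> i'" for i i' j j'
  proof -
    have "indep_var borel (\<lambda>\<omega>. hip (axis j 1) (Y i \<omega>)) borel (\<lambda>\<omega>. hip (axis j' 1) (Y i' \<omega>))"
      using indep_var_compose[OF indep_var_pair[OF ind that] borel_measurable_hip borel_measurable_hip]
      by (simp add: comp_def)
    from cov_indep[OF this W[OF that(1)] W[OF that(2)]] show ?thesis
      by (simp add: hip_axis_left)
  qed
  ultimately show ?thesis
    by blast
qed

text \<open>Independence is assumed for the events of the raw variables; a measurable function of a
  variable generates no further events, so centred or embedded sources inherit it.\<close>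

lemma gen_events_comp:
  assumes "X \<in> measurable M N" "f \<in> measurable N N'"
  shows "gen_events M (\<lambda>\<omega>. f (X \<omega>)) N' \<subseteq> gen_events M X N"
proof
  fix A assume "A \<in> gen_events M (\<lambda>\<omega>. f (X \<omega>)) N'"
  then obtain B where B: "B \<in> sets N'" "A = (\<lambda>\<omega>. f (X \<omega>)) -` B \<inter> space M"
    by (auto simp: gen_events_def)
  then have "A = X -` (f -` B \<inter> space N) \<inter> space M"
    using measurable_space[OF assms(1)] by auto
  moreover have "f -` B \<inter> space N \<in> sets N"
    using B(1) assms(2) by (rule measurable_sets[rotated])
  ultimately show "A \<in> gen_events M X N"
    unfolding gen_events_def by blast
qed

text \<open>Satellite antennas and APs are merged into one bilinear sum over the disjoint union
  \<open>UNIV <+> S\<close>, with zero means on the AP side. Estimates and channels are paired only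
  at equal indices, so their cross-covariance enters through \<open>trace D\<close> and the sum of
  \<open>d\<close>.\<close>

lemma bilinear_vector_scalar:
  fixes es hs :: "'n::finite \<Rightarrow> 'a \<Rightarrow> complex" and ea ha :: "'i \<Rightarrow> 'a \<Rightarrow> complex"
    and a b :: "complex^'n" and S :: "'i set"
  assumes H: "wick_space H" and S: "finite S"
    and mem: "\<And>j. es j \<in> H" "\<And>j. hs j \<in> H" "\<And>m. m \<in> S \<Longrightarrow> ea m \<in> H" "\<And>m. m \<in> S \<Longrightarrow> ha m \<in> H"
    and C: "\<And>i j. cov (es i) (es j) = C $ i $ j" and R: "\<And>i j. cov (hs i) (hs j) = R $ i $ j"
    and D: "\<And>i j. cov (hs i) (es j) = D $ i $ j"
    and ga: "\<And>m m'. m \<in> S \<Longrightarrow> m' \<in> S \<Longrightarrow> cov (ea m) (ea m') = (if m = m' then ga m else 0)"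
    and be: "\<And>m m'. m \<in> S \<Longrightarrow> m' \<in> S \<Longrightarrow> cov (ha m) (ha m') = (if m = m' then be m else 0)"
    and d: "\<And>m. m \<in> S \<Longrightarrow> cov (ha m) (ea m) = d m"
    and x: "\<And>j m. m \<in> S \<Longrightarrow> cov (es j) (ea m) = 0" "\<And>j m. m \<in> S \<Longrightarrow> cov (hs j) (ha m) = 0"
    and z: "\<And>\<omega>. z \<omega> = (\<Sum>j\<in>UNIV. cnj (a $ j + es j \<omega>) * (b $ j + hs j \<omega>)) + (\<Sum>m\<in>S. cnj (ea m \<omega>) * ha m \<omega>)"
  shows "(LINT \<omega>|M. z \<omega>) = hip a b + trace D + (\<Sum>m\<in>S. d m)"
    and "complex_of_real (LINT \<omega>|M. (cmod (z \<omega>))\<^sup>2)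
      = complex_of_real ((cmod (hip a b + trace D + (\<Sum>m\<in>S. d m)))\<^sup>2)
        + hip a (R *v a) + hip b (C *v b) + trace (R ** C) + (\<Sum>m\<in>S. ga m * be m)"
proof -
  define I where "I = (UNIV :: 'n::finite set) <+> S"
  define A where "A = case_sum (\<lambda>j. a $ j) (\<lambda>_::'i. 0)"
  define B where "B = case_sum (\<lambda>j. b $ j) (\<lambda>_::'i. 0)"
  define e where "e = case_sum es ea"
  define h where "h = case_sum hs ha"
  have plus: "sum f I = (\<Sum>j\<in>UNIV. f (Inl j)) + (\<Sum>m\<in>S. f (Inr m))" for f :: "'n + 'i \<Rightarrow> complex"
    unfolding I_def using S by (subst sum.Plus) auto
  note df = A_def B_def e_def h_def
  have x': "cov (ea m) (es j) = 0" "cov (ha m) (hs j) = 0" if "m \<in> S" for j m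
    using x[OF that] by (metis cov_cnj complex_cnj_zero)+
  have mem': "e i \<in> H" "h i \<in> H" if "i \<in> I" for i
    using that mem by (auto simp: I_def df)
  have zz: "z = (\<lambda>\<omega>. \<Sum>i\<in>I. cnj (A i + e i \<omega>) * (B i + h i \<omega>))"
    unfolding plus by (simp add: df z fun_eq_iff)
  have m: "(\<Sum>i\<in>I. cnj (A i) * B i + cov (h i) (e i)) = hip a b + trace D + (\<Sum>m\<in>S. d m)"
    unfolding plus by (simp add: df D d hip_def trace_def sum.distrib)
  show "(LINT \<omega>|M. z \<omega>) = hip a b + trace D + (\<Sum>m\<in>S. d m)"
    unfolding zz m[symmetric]
    by (intro has_bochner_integral_integral_eq bilinear_mean[OF H] mem')
  have 1: "(\<Sum>i\<in>I. \<Sum>j\<in>I. cnj (A i) * A j * cov (h i) (h j)) = hip a (R *v a)"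
    unfolding plus by (simp add: df R hip_matrix_vector)
  have 2: "(\<Sum>i\<in>I. \<Sum>j\<in>I. B i * cnj (B j) * cov (e j) (e i)) = hip b (C *v b)"
    unfolding plus by (simp add: df C hip_matrix_vector) (subst sum.swap, simp add: mult_ac)
  have "(\<Sum>m\<in>S. \<Sum>m'\<in>S. cov (ea m') (ea m) * cov (ha m) (ha m')) = (\<Sum>m\<in>S. ga m * be m)"
  proof (rule sum.cong[OF refl])
    fix m assume m: "m \<in> S"
    have "(\<Sum>m'\<in>S. cov (ea m') (ea m) * cov (ha m) (ha m')) = (\<Sum>m'\<in>S. if m = m' then ga m * be m else 0)"
      by (rule sum.cong) (auto simp: ga be m)
    then show "(\<Sum>m'\<in>S. cov (ea m') (ea m) * cov (ha m) (ha m')) = ga m * be m"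
      using m S by simp
  qed
  then have 3: "(\<Sum>i\<in>I. \<Sum>j\<in>I. cov (e j) (e i) * cov (h i) (h j)) = trace (R ** C) + (\<Sum>m\<in>S. ga m * be m)"
    unfolding plus by (simp add: df C R x x' trace_def matrix_matrix_mult_def mult.commute)
  show "complex_of_real (LINT \<omega>|M. (cmod (z \<omega>))\<^sup>2)
      = complex_of_real ((cmod (hip a b + trace D + (\<Sum>m\<in>S. d m)))\<^sup>2)
        + hip a (R *v a) + hip b (C *v b) + trace (R ** C) + (\<Sum>m\<in>S. ga m * be m)"
    unfolding zz using bilinear_second_moment[OF H, of I e h A B] mem' by (simp add: m 1 2 3)
qed

end

section \<open>Covariances of MMSE estimates\<close>

definition adj :: "complex^'n^'m \<Rightarrow> complex^'m^'n" where
  "adj A = (\<chi> i j. cnj (A $ j $ i))"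

lemma adj_mult: "adj (A ** B) = adj B ** adj A"
  by (simp add: adj_def matrix_matrix_mult_def vec_eq_iff mult.commute)

lemma adj_mat_1: "adj (mat 1) = mat 1"
  by (simp add: adj_def mat_def vec_eq_iff)

lemma adj_hermitian_psd: "hermitian_psd R \<Longrightarrow> adj R = R"
  by (simp add: adj_def vec_eq_iff hermitian_psd_cnj)

lemma adj_add: "adj (A + B) = adj A + adj B"
  by (simp add: adj_def vec_eq_iff)

lemma adj_scaleR: "adj (r *\<^sub>R A) = r *\<^sub>R adj A"
  by (simp add: adj_def vec_eq_iff)

lemma adj_sum: "adj (sum f I) = (\<Sum>i\<in>I. adj (f i))"
  by (simp add: adj_def vec_eq_iff sum_component)

lemma hip_sum_matrix:
  "hip x ((\<Sum>i\<in>I. r *\<^sub>R A i) *v x) = (\<Sum>i\<in>I. of_real r * hip x (A i *v x))"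
proof -
  have "hip x ((\<Sum>i\<in>I. r *\<^sub>R A i) *v x)
      = (\<Sum>j\<in>UNIV. \<Sum>l\<in>UNIV. \<Sum>i\<in>I. of_real r * (cnj (x $ j) * x $ l * A i $ j $ l))"
    unfolding hip_matrix_vector
    by (simp add: sum_distrib_left scaleR_conv_of_real[where 'a=complex] mult_ac)
  also have "\<dots> = (\<Sum>i\<in>I. \<Sum>j\<in>UNIV. \<Sum>l\<in>UNIV. of_real r * (cnj (x $ j) * x $ l * A i $ j $ l))"
    by (subst sum.swap[of _ I], subst sum.swap[of _ I]) (rule refl)
  finally show ?thesis
    by (simp add: hip_matrix_vector sum_distrib_left)
qed

text \<open>The noise term makes A positive definite: Re (x^H A x) \<ge> s |x|^2, so the kernel is
  trivial. As A is Hermitian, the adjoint of its inverse is a left inverse too, and inverses are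
  unique.\<close>

lemma regularised_inverse:
  fixes R :: "'i \<Rightarrow> complex^'n^'n"
  assumes R: "\<And>i. i \<in> I \<Longrightarrow> hermitian_psd (R i)" and r: "0 \<le> r" and s: "0 < s"
  defines "A \<equiv> (\<Sum>i\<in>I. r *\<^sub>R R i) + s *\<^sub>R mat 1"
  shows "A ** matrix_inv A = mat 1" "matrix_inv A ** A = mat 1" "adj (matrix_inv A) = matrix_inv A"
proof -
  have "x = 0" if x: "A *v x = 0" for x
  proof -
    have "hip x (A *v x) = (\<Sum>i\<in>I. of_real r * hip x (R i *v x)) + hip x ((s *\<^sub>R mat 1) *v x)"
      unfolding A_def matrix_vector_mult_add_rdistrib hip_add_right hip_sum_matrix ..
    also have "hip x ((s *\<^sub>R mat 1) *v x) = of_real (s * (norm x)\<^sup>2)"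
      using hip_sum_matrix[where I="{()}" and x=x and r=s and A="\<lambda>_. mat 1"] by (simp add: hip_self)
    finally have "Re (hip x (A *v x)) = (\<Sum>i\<in>I. r * Re (hip x (R i *v x))) + s * (norm x)\<^sup>2"
      by simp
    moreover have "0 \<le> (\<Sum>i\<in>I. r * Re (hip x (R i *v x)))"
      using R r by (intro sum_nonneg mult_nonneg_nonneg) (auto simp: hermitian_psd_def)
    moreover have "hip x (A *v x) = 0"
      by (simp add: x hip_def)
    ultimately have "s * (norm x)\<^sup>2 \<le> 0"
      by simp
    with s show ?thesis
      by (simp add: mult_le_0_iff)
  qed
  then obtain B where "B ** A = mat 1"
    using matrix_left_invertible_ker[of A] by blast
  then have "invertible A"
    using matrix_left_right_inverse[of B A] by (auto simp: invertible_def)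
  then show inv: "A ** matrix_inv A = mat 1" "matrix_inv A ** A = mat 1"
    by (simp_all add: invertible_def matrix_inv_def) (metis (mono_tags, lifting) someI_ex)+
  have "adj A = A"
    using R unfolding A_def by (simp add: adj_add adj_sum adj_scaleR adj_mat_1 adj_hermitian_psd)
  then have "adj (matrix_inv A) ** A = mat 1"
    using arg_cong[OF inv(1), of adj] by (simp add: adj_mult adj_mat_1)
  then show "adj (matrix_inv A) = matrix_inv A"
    by (metis inv(1) matrix_mul_assoc matrix_mul_lid matrix_mul_rid)
qed

context prob_space
begin

lemma cov_matrix_left:
  assumes "\<And>l. L4 (y l)" "L4 X"
  shows "cov (\<lambda>\<omega>. \<Sum>l\<in>UNIV. W $ i $ l * y l \<omega>) X = (\<Sum>l\<in>UNIV. W $ i $ l * cov (y l) X)"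
  using assms by (simp add: cov_sum_left L4_cmult cov_cmult_left)

lemma cov_matrix_right:
  assumes "\<And>l. L4 (y l)" "L4 X"
  shows "cov X (\<lambda>\<omega>. \<Sum>l\<in>UNIV. W $ i $ l * y l \<omega>) = (\<Sum>l\<in>UNIV. cov X (y l) * adj W $ l $ i)"
  using assms by (simp add: cov_sum_right L4_cmult cov_cmult_right adj_def) (simp only: mult.commute)

text \<open>The covariance of the observation \<open>y\<close> is the matrix inverted by
  \<open>Phi\<close>, so it cancels one \<open>Phi\<close> in the sandwich (R_k Phi) cov(y) (Phi
  R_k). The channel of user \<open>k'\<close> meets \<open>y\<close> only if it is among the users
  in \<open>P\<close>, which gives the case distinction.\<close>

lemma vector_estimate_cov:
  fixes G :: "nat \<Rightarrow> 'n::finite \<Rightarrow> 'a \<Rightarrow> complex" and R :: "nat \<Rightarrow> complex^'n^'n"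
  assumes P: "finite P" "P \<subseteq> S" "k \<in> P" and R: "\<And>k'. k' \<in> P \<Longrightarrow> hermitian_psd (R k')"
    and pt: "0 < pt" and v: "0 < v"
    and L: "\<And>k' i. k' \<in> S \<Longrightarrow> L4 (G k' i)" "\<And>i. L4 (N i)"
    and cG: "\<And>k' k'' i j. k' \<in> S \<Longrightarrow> k'' \<in> S \<Longrightarrow> cov (G k' i) (G k'' j) = (if k' = k'' then R k' $ i $ j else 0)"
    and cN: "\<And>i j. cov (N i) (N j) = (if i = j then of_real v else 0)"
    and cGN: "\<And>k' i j. k' \<in> S \<Longrightarrow> cov (G k' i) (N j) = 0"
  defines "Phi \<equiv> matrix_inv ((\<Sum>k'\<in>P. pt *\<^sub>R R k') + v *\<^sub>R mat 1)"
  defines "y \<equiv> \<lambda>l \<omega>. of_real (sqrt pt) * (\<Sum>k'\<in>P. G k' l \<omega>) + N l \<omega>"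
  defines "e \<equiv> \<lambda>i \<omega>. of_real (sqrt pt) * (\<Sum>l\<in>UNIV. (R k ** Phi) $ i $ l * y l \<omega>)"
  shows "cov (e i) (e j) = of_real pt * (R k ** Phi ** R k) $ i $ j"
    and "k' \<in> S \<Longrightarrow> cov (G k' i) (e j) = (if k' \<in> P then of_real pt * (R k' ** Phi ** R k) $ i $ j else 0)"
proof -
  let ?A = "(\<Sum>k'\<in>P. pt *\<^sub>R R k') + v *\<^sub>R mat 1"
  note inv = regularised_inverse[where I=P and R=R and r=pt and s=v, OF R less_imp_le[OF pt] v, folded Phi_def]
  have sq: "of_real (sqrt pt) * of_real (sqrt pt) = (of_real pt :: complex)"
    using pt by (simp flip: of_real_mult)
  have LG: "L4 (G k' i)" if "k' \<in> P" for k' i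
    using L(1) P(2) that by blast
  have Ly: "L4 (y l)" for l
    unfolding y_def by (intro L4_add L4_cmult L4_sum LG L)
  have cGG: "(\<Sum>k''\<in>P. cov (G k' i) (G k'' j)) = (if k' \<in> P then R k' $ i $ j else 0)" if "k' \<in> S" for k' i j
  proof -
    have "(\<Sum>k''\<in>P. cov (G k' i) (G k'' j)) = (\<Sum>k''\<in>P. if k' = k'' then R k' $ i $ j else 0)"
      using P(2) that by (intro sum.cong) (auto simp: cG)
    then show ?thesis using P(1) by simp
  qed
  have cGy: "cov (G k' i) (y j) = (if k' \<in> P then of_real (sqrt pt) * R k' $ i $ j else 0)" if "k' \<in> S" for k' i j
    unfolding y_def
    by (simp add: cov_add_right cov_cmult_right cov_sum_right L4_cmult L4_sum LG L that cGG cGN)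
  have cNy: "cov (N i) (y j) = (if i = j then of_real v else 0)" for i j
  proof -
    have "cov (N i) (G k' j) = 0" if "k' \<in> P" for k'
      using cGN[of k' j i] cov_cnj[of "G k' j" "N i"] that P(2) by auto
    then show ?thesis
      unfolding y_def
      by (simp add: cov_add_right cov_cmult_right cov_sum_right L4_cmult L4_sum LG L cN)
  qed
  have cy: "cov (y i) (y j) = ?A $ i $ j" for i j
  proof -
    have "cov (y i) (y j) = of_real (sqrt pt) * (\<Sum>k'\<in>P. cov (G k' i) (y j)) + cov (N i) (y j)"
      by (subst y_def) (simp add: cov_add_left cov_cmult_left cov_sum_left L4_cmult L4_sum LG L Ly)
    also have "(\<Sum>k'\<in>P. cov (G k' i) (y j)) = (\<Sum>k'\<in>P. of_real (sqrt pt) * R k' $ i $ j)"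
      using P(2) by (intro sum.cong) (auto simp: cGy)
    finally show ?thesis
      using sq by (simp add: cNy sum_distrib_left scaleR_conv_of_real[where 'a=complex] mat_def flip: mult.assoc)
  qed
  \<comment> \<open>The conjugate-linear argument of \<open>cov\<close> brings in the adjoint of the
    filter; Hermitian \<open>R k\<close> and \<open>Phi\<close> turn it into the reversed
    product.\<close>
  have adjW: "adj (R k ** Phi) = Phi ** R k"
    using inv(3) by (simp add: adj_mult adj_hermitian_psd[OF R[OF P(3)]])
  have ce: "cov X (e j) = of_real (sqrt pt) * (\<Sum>l\<in>UNIV. cov X (y l) * (Phi ** R k) $ l $ j)" if "L4 X" for X j
    unfolding e_def by (simp add: cov_cmult_right cov_matrix_right Ly that adjW)
  show "cov (G k' i) (e j) = (if k' \<in> P then of_real pt * (R k' ** Phi ** R k) $ i $ j else 0)" if "k' \<in> S"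
  proof -
    have "cov (G k' i) (e j) = (if k' \<in> P then of_real (sqrt pt) * of_real (sqrt pt) *
        (\<Sum>l\<in>UNIV. R k' $ i $ l * (Phi ** R k) $ l $ j) else 0)"
      by (simp add: ce L that cGy sum_distrib_left mult_ac)
    also have "(\<Sum>l\<in>UNIV. R k' $ i $ l * (Phi ** R k) $ l $ j) = (R k' ** (Phi ** R k)) $ i $ j"
      by (simp add: matrix_matrix_mult_def)
    finally show ?thesis
      by (simp add: sq matrix_mul_assoc)
  qed
  have "cov (e i) (e j) = of_real (sqrt pt) * of_real (sqrt pt) *
      (\<Sum>m\<in>UNIV. (R k ** Phi) $ i $ m * (\<Sum>l\<in>UNIV. ?A $ m $ l * (Phi ** R k) $ l $ j))"
  proof -
    have Le: "L4 (e j)"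
      unfolding e_def by (intro L4_cmult L4_sum Ly)
    have "cov (e i) (e j) = of_real (sqrt pt) * (\<Sum>m\<in>UNIV. (R k ** Phi) $ i $ m * cov (y m) (e j))"
      by (subst e_def) (simp add: cov_cmult_left cov_matrix_left Ly Le)
    then show ?thesis
      by (simp only: ce[OF Ly] cy) (simp add: sum_distrib_left mult_ac)
  qed
  also have "(\<Sum>m\<in>UNIV. (R k ** Phi) $ i $ m * (\<Sum>l\<in>UNIV. ?A $ m $ l * (Phi ** R k) $ l $ j))
      = (R k ** Phi ** (?A ** (Phi ** R k))) $ i $ j"
    by (simp add: matrix_matrix_mult_def)
  also have "?A ** (Phi ** R k) = R k"
    using inv(1) by (simp add: matrix_mul_assoc)
  finally show "cov (e i) (e j) = of_real pt * (R k ** Phi ** R k) $ i $ j"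
    by (simp add: sq)
qed

text \<open>The one-dimensional counterpart, with \<open>D\<close> the variance of the pilot
  observation; one factor \<open>D\<close> cancels in c^2 D.\<close>

lemma scalar_estimate_cov:
  fixes G :: "nat \<Rightarrow> 'a \<Rightarrow> complex" and \<beta> :: "nat \<Rightarrow> real"
  assumes P: "finite P" "P \<subseteq> S" "k \<in> P" and b: "\<And>k'. k' \<in> P \<Longrightarrow> 0 < \<beta> k'"
    and pt: "0 < pt" and v: "0 < v"
    and L: "\<And>k'. k' \<in> S \<Longrightarrow> L4 (G k')" "L4 N"
    and cG: "\<And>k' k''. k' \<in> S \<Longrightarrow> k'' \<in> S \<Longrightarrow> cov (G k') (G k'') = (if k' = k'' then of_real (\<beta> k') else 0)"
    and cN: "cov N N = of_real v"
    and cGN: "\<And>k'. k' \<in> S \<Longrightarrow> cov (G k') N = 0"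
  defines "D \<equiv> (\<Sum>k'\<in>P. pt * \<beta> k') + v"
  defines "e \<equiv> \<lambda>\<omega>. of_real (sqrt pt * \<beta> k / D) * (of_real (sqrt pt) * (\<Sum>k'\<in>P. G k' \<omega>) + N \<omega>)"
  shows "cov e e = of_real (pt * (\<beta> k)\<^sup>2 / D)"
    and "k' \<in> S \<Longrightarrow> cov (G k') e = (if k' \<in> P then of_real (pt * \<beta> k * \<beta> k' / D) else 0)"
proof -
  let ?y = "\<lambda>\<omega>. of_real (sqrt pt) * (\<Sum>k'\<in>P. G k' \<omega>) + N \<omega>"
  have sq: "sqrt pt * sqrt pt = pt" "of_real (sqrt pt) * of_real (sqrt pt) = (of_real pt :: complex)"
    using pt by (simp_all flip: of_real_mult)
  have D: "0 < D"
    unfolding D_def using b pt v by (intro add_nonneg_pos sum_nonneg) (auto simp: less_imp_le)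
  have LG: "L4 (G k')" if "k' \<in> P" for k'
    using L(1) P(2) that by blast
  have Ly: "L4 ?y"
    by (intro L4_add L4_cmult L4_sum LG L)
  have cGG: "(\<Sum>k''\<in>P. cov (G k') (G k'')) = (if k' \<in> P then of_real (\<beta> k') else 0)" if "k' \<in> S" for k'
  proof -
    have "(\<Sum>k''\<in>P. cov (G k') (G k'')) = (\<Sum>k''\<in>P. if k' = k'' then of_real (\<beta> k') else 0)"
      using P(2) that by (intro sum.cong) (auto simp: cG)
    then show ?thesis using P(1) by simp
  qed
  have cGy: "cov (G k') ?y = (if k' \<in> P then of_real (sqrt pt * \<beta> k') else 0)" if "k' \<in> S" for k'
    by (simp add: cov_add_right cov_cmult_right cov_sum_right L4_cmult L4_sum LG L that cGG cGN)
  have cNG: "cov N (G k') = 0" if "k' \<in> P" for k'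
    using cGN[of k'] cov_cnj[of "G k'" N] that P(2) by auto
  have cNy: "cov N ?y = of_real v"
    by (simp add: cov_add_right cov_cmult_right cov_sum_right L4_cmult L4_sum LG L cN cNG)
  have "cov ?y ?y = of_real (sqrt pt) * (\<Sum>k'\<in>P. cov (G k') ?y) + cov N ?y"
    using Ly by (simp add: cov_add_left cov_cmult_left cov_sum_left L4_cmult L4_sum LG L)
  also have "(\<Sum>k'\<in>P. cov (G k') ?y) = (\<Sum>k'\<in>P. of_real (sqrt pt * \<beta> k'))"
    using P(2) by (intro sum.cong) (auto simp: cGy)
  also have "of_real (sqrt pt) * (\<Sum>k'\<in>P. of_real (sqrt pt * \<beta> k')) + cov N ?y = of_real D"
    unfolding cNy D_def using sq by (simp add: sum_distrib_left flip: mult.assoc)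
  finally have cy: "cov ?y ?y = of_real D" .
  have "cov e e = of_real (sqrt pt * \<beta> k / D * (sqrt pt * \<beta> k / D) * D)"
    unfolding e_def cov_cmult_left cov_cmult_right cy by simp
  also have "sqrt pt * \<beta> k / D * (sqrt pt * \<beta> k / D) * D = pt * (\<beta> k)\<^sup>2 / D"
    using D sq(1) by (simp add: field_simps power2_eq_square)
  finally show "cov e e = of_real (pt * (\<beta> k)\<^sup>2 / D)" .
  show "cov (G k') e = (if k' \<in> P then of_real (pt * \<beta> k * \<beta> k' / D) else 0)" if "k' \<in> S"
  proof -
    have "sqrt pt * \<beta> k / D * (sqrt pt * \<beta> k') = sqrt pt * sqrt pt * \<beta> k * \<beta> k' / D"
      by simp
    then have "sqrt pt * \<beta> k / D * (sqrt pt * \<beta> k') = pt * \<beta> k * \<beta> k' / D"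
      unfolding sq(1) .
    then show ?thesis
      unfolding e_def cov_cmult_right cGy[OF that] complex_cnj_complex_of_real
      by (cases "k' \<in> P") (simp_all only: if_True if_False mult_zero_right of_real_mult[symmetric])
  qed
qed

end

section \<open>The closed form\<close>

text \<open>Complex multiples of matrices are written entrywise from here on, which is the form in
  which covariances of components arise.\<close>

lemma hip_scaled_matrix: "hip x ((\<chi> i j. c * A $ i $ j) *v x) = c * hip x (A *v x)"
  by (simp add: hip_matrix_vector sum_distrib_left mult_ac)

lemma trace_scaled: "trace (\<chi> i j. c * A $ i $ j) = c * trace (A :: complex^'n^'n)"
  by (simp add: trace_def sum_distrib_left)

lemma trace_mult_scaled:
  "trace (B ** (\<chi> i j. c * A $ i $ j)) = c * trace (B ** (A :: complex^'n^'n))"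
  by (simp add: trace_def matrix_matrix_mult_def sum_distrib_left mult_ac)

lemma cnj_trace: "cnj (trace A) = trace (adj A)"
  by (simp add: trace_def adj_def)

lemma hip_const_vector: "hip a (\<chi> j. x) = cnj (\<Sum>j\<in>UNIV. a $ j) * x"
  by (simp add: hip_def sum_distrib_right)

lemma borel_measurable_const_vector [measurable]:
  "(\<lambda>x. (\<chi> j. x) :: complex^'n) \<in> borel_measurable borel"
  by (intro borel_measurable_continuous_onI continuous_intros)

theorem theorem1:
  fixes PS :: "'a measure"
    and M K tp tc :: nat
    and p B sa2 ss2 :: real
    and beta :: "nat \<Rightarrow> nat \<Rightarrow> real"
    and gbar :: "nat \<Rightarrow> complex^'n"
    and Rm :: "nat \<Rightarrow> complex^'n^'n"
    and pil :: "nat \<Rightarrow> nat"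
    and Q :: "nat set"
    and rho :: "nat \<Rightarrow> real"
    and g :: "nat \<Rightarrow> nat \<Rightarrow> 'a \<Rightarrow> complex"
    and gs :: "nat \<Rightarrow> 'a \<Rightarrow> complex^'n"
    and na :: "nat \<Rightarrow> nat \<Rightarrow> 'a \<Rightarrow> complex"
    and nsat :: "nat \<Rightarrow> 'a \<Rightarrow> complex^'n"
    and wa :: "nat \<Rightarrow> 'a \<Rightarrow> complex"
    and ws :: "'a \<Rightarrow> complex^'n"
    and k :: nat
  assumes PS: "prob_space PS"
    and tp: "1 \<le> tp" "tp < tc"
    and p: "0 < p" and B: "0 < B" and sa2: "0 < sa2" and ss2: "0 < ss2"
    and beta: "\<forall>m\<in>{1..M}. \<forall>k\<in>{1..K}. 0 < beta m k"
    and Rm: "\<forall>k\<in>{1..K}. hermitian_psd (Rm k)"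
    and pil: "\<forall>k\<in>{1..K}. pil k \<in> {1..tp}"
    and Q: "Q \<subseteq> {1..K}" and k: "k \<in> Q"
    and rho: "\<forall>k\<in>{1..K}. 0 \<le> rho k" "\<forall>k\<in>{1..K} - Q. rho k = 0"
    and dist_g: "\<forall>m\<in>{1..M}. \<forall>k\<in>{1..K}. cgauss PS (g m k) (beta m k)"
    and dist_gs: "\<forall>k\<in>{1..K}. cgauss_vec PS (gs k) (gbar k) (Rm k)"
    and dist_na: "\<forall>m\<in>{1..M}. \<forall>t\<in>{1..tp}. cgauss PS (na m t) sa2"
    and dist_nsat: "\<forall>t\<in>{1..tp}. cgauss_vec PS (nsat t) 0 (ss2 *\<^sub>R mat 1)"
    and dist_wa: "\<forall>m\<in>{1..M}. cgauss PS (wa m) sa2"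
    and dist_ws: "cgauss_vec PS ws 0 (ss2 *\<^sub>R mat 1)"
    and indep: "prob_space.indep_sets PS
       (\<lambda>i. case i of
            ApCh m k' \<Rightarrow> gen_events PS (g m k') borel
          | SatCh k' \<Rightarrow> gen_events PS (gs k') borel
          | ApPil m t \<Rightarrow> gen_events PS (na m t) borel
          | SatPil t \<Rightarrow> gen_events PS (nsat t) borel
          | ApDat m \<Rightarrow> gen_events PS (wa m) borel
          | SatDat \<Rightarrow> gen_events PS ws borel)
       ({ApCh m k' | m k'. m \<in> {1..M} \<and> k' \<in> {1..K}} \<union> SatCh ` {1..K}
        \<union> {ApPil m t | m t. m \<in> {1..M} \<and> t \<in> {1..tp}} \<union> SatPil ` {1..tp}
        \<union> ApDat ` {1..M} \<union> {SatDat})"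
  shows "let P = pset K pil;
             pt = p * real tp;
             uap = ap_est pt sa2 beta P pil g na;
             usat = sat_est pt ss2 Rm gbar P pil gs nsat;
             s = sinr_eff PS M Q rho uap usat g gs wa ws k;
             cf = sinr_closed K M Q rho pt sa2 ss2 beta gbar Rm P k
         in complex_of_real s = cf \<and> rate B tp tc s = rate B tp tc (Re cf)"
proof -
  interpret prob_space PS by (rule PS)
  define P where "P = pset K pil"
  define pt where "pt = p * real tp"
  have pt: "0 < pt"
    using p tp by (simp add: pt_def)
  have kK: "k \<in> {1..K}"
    using Q k by blast
  have Pk: "finite (P k)" "P k \<subseteq> {1..K}" "k \<in> P k"
    using kK by (auto simp: P_def pset_def)
  have pilk: "pil k \<in> {1..tp}"
    using pil kK by blast
  define uap where "uap = ap_est pt sa2 beta P pil g na"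
  define usat where "usat = sat_est pt ss2 Rm gbar P pil gs nsat"

  \<comment> \<open>The independent sources and their linear space\<close>
  define J where "J = {ApCh m k' | m k'. m \<in> {1..M} \<and> k' \<in> {1..K}} \<union> SatCh ` {1..K}
        \<union> {ApPil m t | m t. m \<in> {1..M} \<and> t \<in> {1..tp}} \<union> SatPil ` {1..tp}
        \<union> ApDat ` {1..M} \<union> {SatDat}"
  have JI: "\<And>m k'. m \<in> {1..M} \<Longrightarrow> k' \<in> {1..K} \<Longrightarrow> ApCh m k' \<in> J"
    "\<And>k'. k' \<in> {1..K} \<Longrightarrow> SatCh k' \<in> J"
    "\<And>m t. m \<in> {1..M} \<Longrightarrow> t \<in> {1..tp} \<Longrightarrow> ApPil m t \<in> J"
    "\<And>t. t \<in> {1..tp} \<Longrightarrow> SatPil t \<in> J" "\<And>m. m \<in> {1..M} \<Longrightarrow> ApDat m \<in> J" "SatDat \<in> J"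
    unfolding J_def by blast+
  \<comment> \<open>As images of finite products the comprehensions are visibly finite.\<close>
  have "{ApCh m k' | m k'. m \<in> {1..M} \<and> k' \<in> {1..K}} = (\<lambda>(m, k'). ApCh m k') ` ({1..M} \<times> {1..K})"
    "{ApPil m t | m t. m \<in> {1..M} \<and> t \<in> {1..tp}} = (\<lambda>(m, t). ApPil m t) ` ({1..M} \<times> {1..tp})"
    by auto
  then have finJ: "finite J"
    unfolding J_def by simp
  text \<open>Scalar variables are embedded as constant vectors, so that all sources form one family.\<close>
  define Y :: "rv_index \<Rightarrow> 'a \<Rightarrow> complex^'n" where "Y = (\<lambda>i \<omega>. case i of
            ApCh m k' \<Rightarrow> (\<chi> j. g m k' \<omega>)
          | SatCh k' \<Rightarrow> gs k' \<omega> - gbar k'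
          | ApPil m t \<Rightarrow> (\<chi> j. na m t \<omega>)
          | SatPil t \<Rightarrow> nsat t \<omega>
          | ApDat m \<Rightarrow> (\<chi> j. wa m \<omega>)
          | SatDat \<Rightarrow> ws \<omega>)"
  have YJ: "Y i \<in> borel_measurable PS \<and> (\<forall>a. wick (\<lambda>\<omega>. hip a (Y i \<omega>)))
      \<and> gen_events PS (Y i) borel \<subseteq> (case i of
            ApCh m k' \<Rightarrow> gen_events PS (g m k') borel
          | SatCh k' \<Rightarrow> gen_events PS (gs k') borel
          | ApPil m t \<Rightarrow> gen_events PS (na m t) borel
          | SatPil t \<Rightarrow> gen_events PS (nsat t) borel
          | ApDat m \<Rightarrow> gen_events PS (wa m) borel
          | SatDat \<Rightarrow> gen_events PS ws borel)" if "i \<in> J" for i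
  proof -
    have sc: "(\<lambda>\<omega>. (\<chi> j. X \<omega>) :: complex^'n) \<in> borel_measurable PS \<and> (\<forall>a :: complex^'n. wick (\<lambda>\<omega>. hip a (\<chi> j. X \<omega>)))
      \<and> gen_events PS (\<lambda>\<omega>. (\<chi> j. X \<omega>) :: complex^'n) borel \<subseteq> gen_events PS X borel"
      if "cgauss PS X v" for X v
    proof (intro conjI allI)
      have [measurable]: "X \<in> borel_measurable PS"
        using that by (simp add: cgauss_def)
      show "(\<lambda>\<omega>. (\<chi> j. X \<omega>) :: complex^'n) \<in> borel_measurable PS"
        by measurable
      show "wick (\<lambda>\<omega>. hip a (\<chi> j. X \<omega>))" for a :: "complex^'n"
        unfolding hip_const_vector by (intro wick_cmult cgauss_wick(1)[OF that])
      show "gen_events PS (\<lambda>\<omega>. (\<chi> j. X \<omega>) :: complex^'n) borel \<subseteq> gen_events PS X borel"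
        by (rule gen_events_comp) measurable
    qed
    have vc: "(\<lambda>\<omega>. X \<omega> - mu) \<in> borel_measurable PS \<and> (\<forall>a. wick (\<lambda>\<omega>. hip a (X \<omega> - mu)))
      \<and> gen_events PS (\<lambda>\<omega>. X \<omega> - mu) borel \<subseteq> gen_events PS X borel"
      if "cgauss_vec PS X mu R" for X and mu :: "complex^'n" and R
    proof (intro conjI allI)
      have [measurable]: "X \<in> borel_measurable PS"
        using that by (simp add: cgauss_vec_def)
      show "(\<lambda>\<omega>. X \<omega> - mu) \<in> borel_measurable PS"
        by measurable
      show "wick (\<lambda>\<omega>. hip a (X \<omega> - mu))" for a
        using that cgauss_wick(1) unfolding cgauss_vec_def by blast
      show "gen_events PS (\<lambda>\<omega>. X \<omega> - mu) borel \<subseteq> gen_events PS X borel"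
        by (rule gen_events_comp) measurable
    qed
    show ?thesis
    proof (cases i)
      case (ApCh m k')
      then have "cgauss PS (g m k') (beta m k')"
        using that dist_g by (auto simp: J_def)
      with sc show ?thesis by (simp add: ApCh Y_def)
    next
      case (SatCh k')
      then have "cgauss_vec PS (gs k') (gbar k') (Rm k')"
        using that dist_gs by (auto simp: J_def)
      with vc show ?thesis by (simp add: SatCh Y_def)
    next
      case (ApPil m t)
      then have "cgauss PS (na m t) sa2"
        using that dist_na by (auto simp: J_def)
      with sc show ?thesis by (simp add: ApPil Y_def)
    next
      case (SatPil t)
      then have "cgauss_vec PS (nsat t) 0 (ss2 *\<^sub>R mat 1)"
        using that dist_nsat by (auto simp: J_def)
      from vc[OF this] show ?thesis by (simp add: SatPil Y_def)
    next
      case (ApDat m)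
      then have "cgauss PS (wa m) sa2"
        using that dist_wa by (auto simp: J_def)
      with sc show ?thesis by (simp add: ApDat Y_def)
    next
      case SatDat
      from vc[OF dist_ws] show ?thesis by (simp add: SatDat Y_def)
    qed
  qed
  have indY: "indep_vars (\<lambda>_. borel) Y J"
    unfolding indep_vars_def2
  proof (intro conjI ballI)
    show "Y i \<in> borel_measurable PS" if "i \<in> J" for i
      using YJ[OF that] by blast
    show "indep_sets (\<lambda>i. {Y i -` A \<inter> space PS | A. A \<in> sets borel}) J"
      by (rule indep_sets_mono_sets[OF indep[folded J_def]]) (use YJ in \<open>auto simp: gen_events_def\<close>)
  qed
  have wY: "\<And>i a. i \<in> J \<Longrightarrow> wick (\<lambda>\<omega>. hip a (Y i \<omega>))"
    using YJ by blast
  obtain H where H: "wick_space H" and YH: "\<And>i j. i \<in> J \<Longrightarrow> (\<lambda>\<omega>. Y i \<omega> $ j) \<in> H"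
    and Y0: "\<And>i i' j j'. i \<in> J \<Longrightarrow> i' \<in> J \<Longrightarrow> i \<noteq> i' \<Longrightarrow> cov (\<lambda>\<omega>. Y i \<omega> $ j) (\<lambda>\<omega>. Y i' \<omega> $ j') = 0"
    using wick_space_indep[OF finJ indY wY] by auto

  \<comment> \<open>Covariances of the sources\<close>
  define G where "G = (\<lambda>k' i \<omega>. gs k' \<omega> $ i - gbar k' $ i)"
  define N where "N = (\<lambda>i \<omega>. nsat (pil k) \<omega> $ i)"
  define W where "W = (\<lambda>i \<omega>. ws \<omega> $ i)"
  note L = wick_space_L4[OF H]
  have eqY: "(\<lambda>\<omega>. Y (ApCh m k') \<omega> $ j) = g m k'" "(\<lambda>\<omega>. Y (SatCh k') \<omega> $ j) = G k' j"
    "(\<lambda>\<omega>. Y (ApPil m t) \<omega> $ j) = na m t" "(\<lambda>\<omega>. Y (SatPil (pil k)) \<omega> $ j) = N j"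
    "(\<lambda>\<omega>. Y (ApDat m) \<omega> $ j) = wa m" "(\<lambda>\<omega>. Y SatDat \<omega> $ j) = W j" for m k' j t
    by (simp_all add: Y_def G_def N_def W_def fun_eq_iff)
  note JI = JI(1,2) JI(3)[OF _ pilk] JI(4)[OF pilk] JI(5,6)
  note mem = YH[OF JI(1), unfolded eqY] YH[OF JI(2), unfolded eqY] YH[OF JI(3), unfolded eqY]
    YH[OF JI(4), unfolded eqY] YH[OF JI(5), unfolded eqY] YH[OF JI(6), unfolded eqY]
  have flip: "cov X Z = 0 \<Longrightarrow> cov Z X = 0" for X Z
    using cov_cnj[of X Z] by simp
  note Y_simps = eqY rv_index.distinct rv_index.inject simp_thms True_implies_equals
  note c0 =
    Y0[OF JI(1) JI(1), simplified Y_simps] Y0[OF JI(1) JI(2), simplified Y_simps] Y0[OF JI(1) JI(3), simplified Y_simps]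
    Y0[OF JI(1) JI(4), simplified Y_simps] Y0[OF JI(1) JI(5), simplified Y_simps] Y0[OF JI(2) JI(2), simplified Y_simps]
    Y0[OF JI(2) JI(3), simplified Y_simps] Y0[OF JI(2) JI(4), simplified Y_simps] Y0[OF JI(2) JI(6), simplified Y_simps]
    Y0[OF JI(3) JI(3), simplified Y_simps] Y0[OF JI(3) JI(4), simplified Y_simps] Y0[OF JI(3) JI(5), simplified Y_simps]
    Y0[OF JI(4) JI(6), simplified Y_simps]
  have cg: "cov (g m k') (g m k') = of_real (beta m k')" if "m \<in> {1..M}" "k' \<in> {1..K}" for m k'
    using cgauss_wick(2) dist_g that by blast
  have cna: "cov (na m (pil k)) (na m (pil k)) = of_real sa2" if "m \<in> {1..M}" for m
    using cgauss_wick(2) dist_na that pilk by blast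
  have cwa: "cov (wa m) (wa m) = of_real sa2" if "m \<in> {1..M}" for m
    using cgauss_wick(2) dist_wa that by blast
  have cG: "cov (G k' i) (G k' j) = Rm k' $ i $ j" if "k' \<in> {1..K}" for k' i j
    unfolding G_def using dist_gs Rm that by (intro cgauss_vec_component hermitian_psd_cnj) auto
  have cN: "cov (N i) (N j) = (ss2 *\<^sub>R mat 1 :: complex^'n^'n) $ i $ j" for i j
    using cgauss_vec_component[where X="nsat (pil k)" and mu=0 and R="ss2 *\<^sub>R mat 1" and i=i and j=j]
      dist_nsat pilk by (simp add: N_def mat_def)
  have cW: "cov (W i) (W j) = (ss2 *\<^sub>R mat 1 :: complex^'n^'n) $ i $ j" for i j
    using cgauss_vec_component[where X=ws and mu=0 and R="ss2 *\<^sub>R mat 1" and i=i and j=j]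
      dist_ws by (simp add: W_def mat_def)

  \<comment> \<open>Fluctuations of the two estimates\<close>
  define Phi where "Phi = matrix_inv ((\<Sum>k'\<in>P k. pt *\<^sub>R Rm k') + ss2 *\<^sub>R mat 1)"
  have Phi_eq: "Phimat pt ss2 Rm P k = Phi"
    by (simp add: Phimat_def Phi_def)
  \<comment> \<open>Using the centred channels \<open>G\<close> absorbs the subtraction of the mean
    observation, so \<open>es\<close> is a linear combination of sources and lies in
    \<open>H\<close>.\<close>
  define es where "es = (\<lambda>i \<omega>. of_real (sqrt pt) * (\<Sum>l\<in>UNIV. (Rm k ** Phi) $ i $ l
      * (of_real (sqrt pt) * (\<Sum>k'\<in>P k. G k' l \<omega>) + N l \<omega>)))"
  define D where "D = (\<lambda>m. (\<Sum>k'\<in>P k. pt * beta m k') + sa2)"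
  define ea where "ea = (\<lambda>m \<omega>. of_real (sqrt pt * beta m k / D m)
      * (of_real (sqrt pt) * (\<Sum>k'\<in>P k. g m k' \<omega>) + na m (pil k) \<omega>))"
  have usat_eq: "usat k \<omega> $ i = gbar k $ i + es i \<omega>" for i \<omega>
    unfolding usat_def sat_est_def es_def Phi_eq matrix_vector_mult_def G_def N_def
    by (simp add: scaleR_conv_of_real[where 'a=complex] sum_subtractf algebra_simps)
  have uap_eq: "uap m k = ea m" for m
    by (simp add: uap_def ap_est_def ea_def cmmse_def D_def fun_eq_iff)
  have es_H: "es i \<in> H" for i
    unfolding es_def using Pk
    by (intro wick_spaceD(2,3)[OF H] wick_space_sum[OF H] mem) auto
  have ea_H: "ea m \<in> H" if "m \<in> {1..M}" for m
    unfolding ea_def using Pk that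
    by (intro wick_spaceD(2,3)[OF H] wick_space_sum[OF H] mem) auto
  have LP: "\<And>k' j. k' \<in> P k \<Longrightarrow> L4 (G k' j)" "\<And>k' m. k' \<in> P k \<Longrightarrow> m \<in> {1..M} \<Longrightarrow> L4 (g m k')"
    "\<And>j. L4 (N j)" "\<And>m. m \<in> {1..M} \<Longrightarrow> L4 (na m (pil k))"
    using Pk mem L by blast+
  \<comment> \<open>An estimate is uncorrelated with whatever is uncorrelated with each of its
    ingredients; all vanishing cross-covariances below reduce to this and to
    \<open>ea0\<close>.\<close>
  have es0: "cov (es j) X = 0"
    if "X \<in> H" "\<And>k' l. k' \<in> P k \<Longrightarrow> cov (G k' l) X = 0" "\<And>l. cov (N l) X = 0" for X j
    unfolding es_def
    by (simp add: cov_add_left cov_cmult_left cov_sum_left L4_add L4_cmult L4_sum LP L that)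
  have ea0: "cov (ea m) X = 0"
    if "m \<in> {1..M}" "X \<in> H" "\<And>k'. k' \<in> P k \<Longrightarrow> cov (g m k') X = 0" "cov (na m (pil k)) X = 0" for X m
    unfolding ea_def
    by (subst cov_cmult_left, use that(1) in \<open>simp add: cov_add_left cov_cmult_left cov_sum_left L4_add L4_cmult L4_sum LP L that\<close>)
  have PkK: "k' \<in> P k \<Longrightarrow> k' \<in> {1..K}" for k'
    using Pk by blast
  note c0' = c0 c0[THEN flip] mem
  have es_ea: "cov (es j) (ea m) = 0" if m: "m \<in> {1..M}" for j m
  proof (rule es0[OF ea_H[OF m]])
    show "cov (G k' l) (ea m) = 0" if "k' \<in> P k" for k' l
      by (rule flip, rule ea0; use m that PkK in \<open>blast intro: c0'\<close>)
    show "cov (N l) (ea m) = 0" for l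
      by (rule flip, rule ea0; use m PkK in \<open>blast intro: c0'\<close>)
  qed
  have ea_ea0: "cov (ea m) (ea m') = 0" if m: "m \<in> {1..M}" "m' \<in> {1..M}" "m \<noteq> m'" for m m'
  proof (rule ea0[OF m(1) ea_H[OF m(2)]])
    show "cov (g m k') (ea m') = 0" if "k' \<in> P k" for k'
      by (rule flip, rule ea0; use m that PkK in \<open>blast intro: c0'\<close>)
    show "cov (na m (pil k)) (ea m') = 0"
      by (rule flip, rule ea0; use m PkK in \<open>blast intro: c0'\<close>)
  qed
  have es_W: "cov (W i) (es j) = 0" for i j
    by (rule flip, rule es0; use PkK in \<open>blast intro: c0'\<close>)
  have ea_wa: "cov (wa m) (ea m) = 0" if "m \<in> {1..M}" for m
    by (rule flip, rule ea0; use that PkK in \<open>blast intro: c0'\<close>)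
  define gam where "gam = (\<lambda>m. pt * (beta m k)\<^sup>2 / D m)"
  have gam_eq: "gmmse pt sa2 beta P m k = gam m" for m
    by (simp add: gam_def gmmse_def D_def)
  define T where "T = Rm k ** Phi ** Rm k"
  have hR: "hermitian_psd (Rm k')" if "k' \<in> P k" for k'
    using Rm PkK[OF that] by blast
  have LG: "L4 (G k' i)" if "k' \<in> {1..K}" for k' i
    using that by (simp add: L mem)
  have LN: "L4 (N i)" for i
    by (simp add: L mem)
  have cG': "cov (G k' i) (G k'' j) = (if k' = k'' then Rm k' $ i $ j else 0)"
    if "k' \<in> {1..K}" "k'' \<in> {1..K}" for k' k'' i j
    using that cG c0 by auto
  have cN': "cov (N i) (N j) = (if i = j then of_real ss2 else 0)" for i j
    by (simp add: cN mat_def scaleR_conv_of_real[where 'a=complex])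
  have cGN: "cov (G k' i) (N j) = 0" if "k' \<in> {1..K}" for k' i j
    by (rule c0(8)[OF that])
  note est = vector_estimate_cov[OF Pk hR pt ss2 LG LN cG' cN' cGN]
  have es_cov: "cov (es i) (es j) = of_real pt * T $ i $ j" for i j
    unfolding es_def Phi_def T_def by (rule est(1))
  have G_es: "cov (G k' i) (es j) = (if k' \<in> P k then of_real pt * (Rm k' ** Phi ** Rm k) $ i $ j else 0)"
    if "k' \<in> {1..K}" for i j k'
    unfolding es_def Phi_def T_def by (rule est(2); (assumption | rule that))
  have ea_cov: "cov (ea m) (ea m) = of_real (gam m)"
    "k' \<in> {1..K} \<Longrightarrow> cov (g m k') (ea m) = (if k' \<in> P k then of_real (pt * beta m k * beta m k' / D m) else 0)"
    if m: "m \<in> {1..M}" for m k'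
  proof -
    have b: "0 < beta m k'" if "k' \<in> P k" for k'
      using beta PkK[OF that] m by blast
    have cg': "cov (g m k') (g m k'') = (if k' = k'' then of_real (beta m k') else 0)"
      if "k' \<in> {1..K}" "k'' \<in> {1..K}" for k' k''
      using that m cg c0 by auto
    have c0g: "cov (g m k') (na m (pil k)) = 0" if "k' \<in> {1..K}" for k'
      using that m c0 by blast
    note est = scalar_estimate_cov[where \<beta>="beta m",
        OF Pk b pt sa2 L[OF mem(1)[OF m]] L[OF mem(3)[OF m]] cg' cna[OF m] c0g]
    show "cov (ea m) (ea m) = of_real (gam m)"
      unfolding ea_def gam_def D_def by (rule est(1))
    show "cov (g m k') (ea m) = (if k' \<in> P k then of_real (pt * beta m k * beta m k' / D m) else 0)"
      if "k' \<in> {1..K}"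
      unfolding ea_def D_def by (rule est(2); (assumption | rule that))
  qed

  \<comment> \<open>Moments of the effective channels\<close>
  define C where "C = (\<chi> i j. of_real pt * T $ i $ j)"
  have C: "cov (es i) (es j) = C $ i $ j" for i j
    by (simp add: C_def es_cov)
  \<comment> \<open>\<open>mn k'\<close> is the mean of \<open>z\<close> for the pair
    \<open>k\<close>, \<open>k'\<close>, the conditional part being pilot contamination;
    \<open>E2 k'\<close> is its variance.\<close>
  define mn where "mn = (\<lambda>k'. hip (gbar k) (gbar k') + (if k' \<in> P k then
      of_real pt * trace (Rm k' ** Phi ** Rm k)
      + of_real (\<Sum>m\<in>{1..M}. cmmse pt sa2 beta P m k' / cmmse pt sa2 beta P m k * gam m) else 0))"
  define E2 where "E2 = (\<lambda>k'. hip (gbar k) (Rm k' *v gbar k) + of_real pt * hip (gbar k') (T *v gbar k')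
      + of_real pt * trace (Rm k' ** T) + of_real (\<Sum>m\<in>{1..M}. gam m * beta m k'))"
  \<comment> \<open>Users sharing a pilot have the same set \<open>P\<close>, hence the same
    denominator \<open>D m\<close>, so the quotient of coefficients is that of the
    \<open>beta\<close>.\<close>
  have ratio: "pt * beta m k * beta m k' / D m = cmmse pt sa2 beta P m k' / cmmse pt sa2 beta P m k * gam m"
    if m: "m \<in> {1..M}" and k': "k' \<in> P k" for m k'
  proof -
    have "P k' = P k"
      using k' by (auto simp: P_def pset_def)
    then have c: "cmmse pt sa2 beta P m k' = sqrt pt * beta m k' / D m"
      "cmmse pt sa2 beta P m k = sqrt pt * beta m k / D m"
      by (simp_all add: cmmse_def D_def)
    have b: "0 < beta m k''" if "k'' \<in> P k" for k''
      using beta m PkK[OF that] by blast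
    have "0 < D m"
      unfolding D_def using pt sa2 b
      by (intro add_nonneg_pos sum_nonneg mult_nonneg_nonneg) (auto simp: less_imp_le)
    then show ?thesis
      unfolding c gam_def using pt b[OF Pk(3)] by (simp add: field_simps power2_eq_square)
  qed
  have z: "(LINT \<omega>|PS. zcomb M uap usat g gs k k' \<omega>) = mn k'"
    "complex_of_real (LINT \<omega>|PS. (cmod (zcomb M uap usat g gs k k' \<omega>))\<^sup>2)
       = of_real ((cmod (mn k'))\<^sup>2) + E2 k'" if k': "k' \<in> {1..K}" for k'
  proof -
    \<comment> \<open>Putting the case distinction into the scalar factor treats users inside and
      outside \<open>P k\<close> by one application of the bilinear formula.\<close>
    define DD where "DD = (\<chi> i j. (if k' \<in> P k then of_real pt else 0) * (Rm k' ** Phi ** Rm k) $ i $ j)"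
    have DD: "cov (G k' i) (es j) = DD $ i $ j" for i j
      by (simp add: DD_def G_es[OF k'])
    define d where "d = (\<lambda>m. if k' \<in> P k then of_real (pt * beta m k * beta m k' / D m) else 0 :: complex)"
    have zc: "zcomb M uap usat g gs k k' \<omega> = (\<Sum>j\<in>UNIV. cnj (gbar k $ j + es j \<omega>) * (gbar k' $ j + G k' j \<omega>))
        + (\<Sum>m\<in>{1..M}. cnj (ea m \<omega>) * g m k' \<omega>)" for \<omega>
      by (simp add: zcomb_def hip_def usat_eq uap_eq G_def)
    have ga: "cov (ea m) (ea m') = (if m = m' then of_real (gam m) else 0)"
      if "m \<in> {1..M}" "m' \<in> {1..M}" for m m'
      using ea_cov ea_ea0 that by auto
    have be: "cov (g m k') (g m' k') = (if m = m' then of_real (beta m k') else 0)"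
      if "m \<in> {1..M}" "m' \<in> {1..M}" for m m'
      using cg k' that c0(1) by auto
    have dd: "cov (g m k') (ea m) = d m" if "m \<in> {1..M}" for m
      using ea_cov(2)[OF that k'] by (simp add: d_def)
    have x: "cov (G k' j) (g m k') = 0" if "m \<in> {1..M}" for j m
      by (rule flip, rule c0(2)[OF that k' k'])
    note bl = bilinear_vector_scalar[OF H finite_atLeastAtMost es_H mem(2)[OF k'] ea_H mem(1)[OF _ k']
        C cG[OF k'] DD ga be dd es_ea x zc]
    have "trace DD = (if k' \<in> P k then of_real pt * trace (Rm k' ** Phi ** Rm k) else 0)"
      unfolding DD_def trace_scaled by simp
    moreover have "(\<Sum>m\<in>{1..M}. d m) = (if k' \<in> P k then
        of_real (\<Sum>m\<in>{1..M}. cmmse pt sa2 beta P m k' / cmmse pt sa2 beta P m k * gam m) else 0)"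
      by (simp add: d_def ratio del: of_real_divide of_real_mult)
    ultimately have m: "hip (gbar k) (gbar k') + trace DD + (\<Sum>m\<in>{1..M}. d m) = mn k'"
      by (simp add: mn_def)
    show "(LINT \<omega>|PS. zcomb M uap usat g gs k k' \<omega>) = mn k'"
      unfolding m[symmetric] by (rule bl(1); assumption)
    show "complex_of_real (LINT \<omega>|PS. (cmod (zcomb M uap usat g gs k k' \<omega>))\<^sup>2)
       = of_real ((cmod (mn k'))\<^sup>2) + E2 k'"
    proof -
      have "complex_of_real (LINT \<omega>|PS. (cmod (zcomb M uap usat g gs k k' \<omega>))\<^sup>2)
          = of_real ((cmod (mn k'))\<^sup>2) + hip (gbar k) (Rm k' *v gbar k) + hip (gbar k') (C *v gbar k')
            + trace (Rm k' ** C) + (\<Sum>m\<in>{1..M}. of_real (gam m) * of_real (beta m k'))"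
        unfolding m[symmetric] by (rule bl(2); assumption)
      then show ?thesis
        by (simp add: E2_def C_def hip_scaled_matrix trace_mult_scaled)
    qed
  qed

  \<comment> \<open>Noise powers\<close>
  have ssI: "hip x ((ss2 *\<^sub>R mat 1) *v x) = of_real (ss2 * (norm x)\<^sup>2)" for x :: "complex^'n"
    using hip_sum_matrix[where I="{()}" and x=x and r=ss2 and A="\<lambda>_. mat 1"] by (simp add: hip_self)
  have trI: "trace ((ss2 *\<^sub>R mat 1) ** A) = of_real ss2 * trace A" for A :: "complex^'n^'n"
    by (simp add: trace_def matrix_matrix_mult_def mat_def scaleR_conv_of_real[where 'a=complex]
        sum_distrib_left if_distrib[of "\<lambda>c. _ * c * _"] cong: if_cong)
  have ns: "complex_of_real (LINT \<omega>|PS. (cmod (hip (usat k \<omega>) (ws \<omega>)))\<^sup>2)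
      = of_real (ss2 * (norm (gbar k))\<^sup>2) + of_real (pt * ss2) * trace T"
  proof -
    \<comment> \<open>The noise plays the part of a channel of mean 0 and covariance
      \<open>ss2\<close> times the identity, uncorrelated with the estimate; the scalar index set is
      empty.\<close>
    have zc: "hip (usat k \<omega>) (ws \<omega>) = (\<Sum>j\<in>UNIV. cnj (gbar k $ j + es j \<omega>) * ((0 :: complex^'n) $ j + W j \<omega>))
        + (\<Sum>m\<in>{}. cnj (ea m \<omega>) * wa m \<omega>)" for \<omega>
      by (simp add: hip_def usat_eq W_def)
    have D0: "cov (W i) (es j) = (0 :: complex^'n^'n) $ i $ j" for i j
      by (simp add: es_W)
    have "complex_of_real (LINT \<omega>|PS. (cmod (hip (usat k \<omega>) (ws \<omega>)))\<^sup>2)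
        = hip (gbar k) ((ss2 *\<^sub>R mat 1) *v gbar k) + trace ((ss2 *\<^sub>R mat 1) ** C)"
      using bilinear_vector_scalar(2)[where S="{}" and hs=W and R="ss2 *\<^sub>R mat 1" and D=0
          and es=es and z="\<lambda>\<omega>. hip (usat k \<omega>) (ws \<omega>)" and a="gbar k" and b=0 and ea=ea and ha=wa and C=C,
          OF H finite.emptyI es_H mem(6) _ _ C cW D0 _ _ _ _ _ zc]
      by (simp add: hip_def trace_0[unfolded mat_0])
    then show ?thesis
      unfolding ssI trI C_def trace_scaled by simp
  qed
  have na: "(LINT \<omega>|PS. (cmod (cnj (uap m k \<omega>) * wa m \<omega>))\<^sup>2) = sa2 * gam m" if m: "m \<in> {1..M}" for m
  proof -
    have "complex_of_real (LINT \<omega>|PS. (cmod (cnj (uap m k \<omega>) * wa m \<omega>))\<^sup>2) = of_real (sa2 * gam m)"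
      using bilinear_second_moment[OF H, where I="{m}" and e=ea and h=wa and a="\<lambda>_. 0" and b="\<lambda>_. 0"]
        ea_H[OF m] mem(5)[OF m]
      by (simp add: uap_eq ea_wa[OF m] ea_cov(1)[OF m] cwa[OF m])
    then show ?thesis
      by (simp only: of_real_eq_iff)
  qed
  have ck: "cmmse pt sa2 beta P m k / cmmse pt sa2 beta P m k * gam m = gam m" if "m \<in> {1..M}" for m
    using ratio[OF that Pk(3)] by (simp add: gam_def power2_eq_square)
  have "(\<Sum>m\<in>{1..M}. cmmse pt sa2 beta P m k / cmmse pt sa2 beta P m k * gam m) = (\<Sum>m\<in>{1..M}. gam m)"
    by (rule sum.cong[OF refl ck])
  then have mnk: "mn k = of_real ((norm (gbar k))\<^sup>2) + of_real pt * trace T + of_real (\<Sum>m\<in>{1..M}. gam m)"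
    unfolding mn_def using Pk(3) by (simp only: if_True hip_self T_def add.assoc)
  \<comment> \<open>The closed form squares a complex number where the effective SINR takes a
    squared modulus. They agree because \<open>mn k\<close> is real, which comes down to the trace
    of the Hermitian \<open>T\<close>.\<close>
  have "adj T = T"
    using regularised_inverse(3)[where I="P k" and R=Rm and r=pt and s=ss2] hR pt ss2
    by (simp add: T_def adj_mult adj_hermitian_psd[OF hR[OF Pk(3)]] matrix_mul_assoc flip: Phi_def)
  then have "cnj (mn k) = mn k"
    unfolding mnk by (simp add: cnj_trace)
  then have mn2: "(mn k)\<^sup>2 = of_real ((cmod (mn k))\<^sup>2)"
    unfolding complex_norm_square by (simp add: power2_eq_square)

  \<comment> \<open>Assembling the quotient\<close>
  define NS where "NS = (LINT \<omega>|PS. (cmod (hip (usat k \<omega>) (ws \<omega>)))\<^sup>2)"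
  define EZ where "EZ = (\<lambda>k'. LINT \<omega>|PS. (cmod (zcomb M uap usat g gs k k' \<omega>))\<^sup>2)"
  define MI where "MI = (\<Sum>k'\<in>P k - {k}. complex_of_real (rho k' * (cmod (mn k'))\<^sup>2))
    + (\<Sum>k'\<in>{1..K} - P k. complex_of_real (rho k' * (cmod (mn k'))\<^sup>2))
    + of_real pt * (\<Sum>k'\<in>Q. of_real (rho k') * hip (gbar k') (T *v gbar k'))
    + (\<Sum>k'\<in>Q. of_real (rho k') * hip (gbar k) (Rm k' *v gbar k))
    + of_real pt * (\<Sum>k'\<in>Q. of_real (rho k') * trace (Rm k' ** T))
    + of_real (\<Sum>k'\<in>Q. \<Sum>m\<in>{1..M}. rho k' * gam m * beta m k')"
  define NO where "NO = of_real (ss2 * (norm (gbar k))\<^sup>2) + of_real (pt * ss2) * trace T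
    + complex_of_real (sa2 * (\<Sum>m\<in>{1..M}. gam m))"
  define den where "den = (\<Sum>k'\<in>Q. rho k' * EZ k') - rho k * (cmod (mn k))\<^sup>2
    + NS + (\<Sum>m\<in>{1..M}. sa2 * gam m)"
  have finQ: "finite Q"
    using Q by (rule finite_subset) simp
  have den: "of_real den = MI + NO"
  proof -
    let ?q = "\<lambda>k'. complex_of_real (rho k' * (cmod (mn k'))\<^sup>2)"
    \<comment> \<open>Inactive users have zero power, so the sum extends to all users and splits
      into \<open>k\<close>, its pilot sharers and the rest. The term of \<open>k\<close> then
      cancels against the subtracted desired signal.\<close>
    have "(\<Sum>k'\<in>Q. ?q k') = (\<Sum>k'\<in>{1..K}. ?q k')"
      using Q rho(2) by (intro sum.mono_neutral_left) auto
    also have "\<dots> = (\<Sum>k'\<in>P k. ?q k') + (\<Sum>k'\<in>{1..K} - P k. ?q k')"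
      using Pk(2) by (subst add.commute, intro sum.subset_diff) auto
    also have "(\<Sum>k'\<in>P k. ?q k') = ?q k + (\<Sum>k'\<in>P k - {k}. ?q k')"
      by (rule sum.remove[OF Pk(1,3)])
    finally have q: "(\<Sum>k'\<in>Q. ?q k') = ?q k + (\<Sum>k'\<in>P k - {k}. ?q k') + (\<Sum>k'\<in>{1..K} - P k. ?q k')" .
    have "complex_of_real (\<Sum>k'\<in>Q. rho k' * EZ k') = (\<Sum>k'\<in>Q. of_real (rho k') * of_real (EZ k'))"
      by simp
    also have "\<dots> = (\<Sum>k'\<in>Q. ?q k' + of_real (rho k') * E2 k')"
      using Q by (intro sum.cong refl) (auto simp: EZ_def z(2) ring_distribs)
    also have "\<dots> = (\<Sum>k'\<in>Q. ?q k') + (of_real pt * (\<Sum>k'\<in>Q. of_real (rho k') * hip (gbar k') (T *v gbar k'))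
      + (\<Sum>k'\<in>Q. of_real (rho k') * hip (gbar k) (Rm k' *v gbar k))
      + of_real pt * (\<Sum>k'\<in>Q. of_real (rho k') * trace (Rm k' ** T))
      + of_real (\<Sum>k'\<in>Q. \<Sum>m\<in>{1..M}. rho k' * gam m * beta m k'))"
      unfolding E2_def by (simp add: sum.distrib sum_distrib_left algebra_simps)
    finally have e: "complex_of_real (\<Sum>k'\<in>Q. rho k' * EZ k') = ?q k + MI"
      unfolding q MI_def by (simp only: add.assoc)
    have "of_real den = complex_of_real (\<Sum>k'\<in>Q. rho k' * EZ k') - ?q k + of_real NS
        + of_real (\<Sum>m\<in>{1..M}. sa2 * gam m)"
      unfolding den_def by (simp only: of_real_add of_real_diff)
    also have "\<dots> = MI + NO"
      unfolding e NO_def NS_def ns sum_distrib_left by (simp only: add.assoc add_diff_cancel_left')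
    finally show ?thesis .
  qed
  have s: "sinr_eff PS M Q rho uap usat g gs wa ws k = rho k * (cmod (mn k))\<^sup>2 / den"
  proof -
    have "(\<Sum>m\<in>{1..M}. LINT \<omega>|PS. (cmod (cnj (uap m k \<omega>) * wa m \<omega>))\<^sup>2) = (\<Sum>m\<in>{1..M}. sa2 * gam m)"
      by (rule sum.cong[OF refl na])
    then show ?thesis
      unfolding sinr_eff_def Let_def z(1)[OF kK] den_def EZ_def NS_def by (simp only:)
  qed
  have cf: "sinr_closed K M Q rho pt sa2 ss2 beta gbar Rm P k = of_real (rho k) * (mn k)\<^sup>2 / (MI + NO)"
  proof -
    have 1: "(\<Sum>k'\<in>P k - {k}. complex_of_real (rho k' * (cmod (mn k'))\<^sup>2))
      = (\<Sum>k'\<in>P k - {k}. complex_of_real (rho k' * (cmod (hip (gbar k) (gbar k')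
                   + complex_of_real pt * trace (Rm k' ** Phi ** Rm k)
                   + complex_of_real (\<Sum>m\<in>{1..M}. cmmse pt sa2 beta P m k' / cmmse pt sa2 beta P m k * gam m)))\<^sup>2))"
      by (intro sum.cong refl) (simp add: mn_def add.assoc)
    have 2: "(\<Sum>k'\<in>{1..K} - P k. complex_of_real (rho k' * (cmod (mn k'))\<^sup>2))
      = (\<Sum>k'\<in>{1..K} - P k. complex_of_real (rho k' * (cmod (hip (gbar k) (gbar k')))\<^sup>2))"
      by (intro sum.cong refl) (simp add: mn_def)
    show ?thesis
      unfolding sinr_closed_def Let_def Phi_eq gam_eq mnk MI_def NO_def 1 2 T_def
      by (simp only: matrix_mul_assoc)
  qed
  \<comment> \<open>Numerators and denominators agree separately, so the quotients agree whatever
    the value of \<open>den\<close>.\<close>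
  have "complex_of_real (sinr_eff PS M Q rho uap usat g gs wa ws k)
      = sinr_closed K M Q rho pt sa2 ss2 beta gbar Rm P k"
    unfolding s cf mn2 den[symmetric] by (simp only: of_real_mult of_real_divide)
  then have "complex_of_real (sinr_eff PS M Q rho uap usat g gs wa ws k)
      = sinr_closed K M Q rho pt sa2 ss2 beta gbar Rm P k \<and>
     rate B tp tc (sinr_eff PS M Q rho uap usat g gs wa ws k)
      = rate B tp tc (Re (sinr_closed K M Q rho pt sa2 ss2 beta gbar Rm P k))"
    by (metis Re_complex_of_real)
  then show ?thesis
    unfolding Let_def P_def[symmetric] pt_def[symmetric] uap_def usat_def .
qed

end
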